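(* Let $\{z^{(k)}\}$ be the iterate sequence generated by PALM-I (described in the context, with $M_l=\gamma L$, $\gamma>1$, $M_u=M\ge M_l$), where $\{\varepsilon^{(k)}\}$ is nonnegative and square summable. Suppose that: (1) for each $i=1,\ldots,n$ there is $L_i>0$ such that $\|\nabla_i f(z_1)-\nabla_i f(z_2)\|\le L_i\|z_1-z_2\|$ for all $z_1,z_2\in\prod_{j=1}^n\bar{\mathcal S}_j$; (2) for each $i=1,\ldots,n$, $\mathcal S_i$ is convex and compact, $h_i$ is linear or satisfies the Slater constraint qualification (there is $\hat x_i\in\mathbb R^{m_i}$ with $h_i(\hat x_i)<0$), and there is a constant $\tilde c_i\ge 0$ such that $\mathrm{dist}(x_i,\mathcal S_i)\le \tilde c_i\|\max\{h_i(x_i),0\}\|$ for all $x_i\in\tilde{\mathcal S}_i$. Let $\Omega(z^{(0)})$ be the set of accumulation points of $\{z^{(k)}\}$, i.e. the set of $z\in\prod_{i=1}^n\mathbb R^{m_i}$ for which there is an infinite $\mathcal K\subseteq\mathbb N$ with $z^{(k)}\to z$ as $k\to\infty$ in $\mathcal K$. Then: (i) $\Omega(z^{(0)})\subseteq\prod_{i=1}^n\mathcal S_i$ is nonempty and each of its elements is a stationary point of $F$; (ii) $\Omega(z^{(0)})$ is compact and connected, and $\mathrm{dist}(\bar z^{(k)},\Omega(z^{(0)}))\to 0$; (iii) $F$ is finite and constant on $\Omega(z^{(0)})$.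
   Context: Problem. $n,m_i,p_i$ are positive integers; $f:\prod_{i=1}^n\mathbb R^{m_i}\to\mathbb R$ is differentiable (not necessarily convex); for $i=1,\ldots,n$, $h_i=(h_{i,1},\ldots,h_{i,p_i})^\top:\mathbb R^{m_i}\to\mathbb R^{p_i}$ is convex and differentiable, and $\mathcal S_i:=\{w\in\mathbb R^{m_i}: h_i(w)\le 0\}$. Write $z=(x_1,\ldots,x_n)$ with $x_i\in\mathbb R^{m_i}$, and $F(z):=f(z)+\sum_{i=1}^n\delta_{\mathcal S_i}(x_i)$, where $\delta_{\mathcal S}$ is the indicator function ($0$ on $\mathcal S$, $+\infty$ off $\mathcal S$). $\nabla_i f$ is the gradient of $f$ with respect to $x_i$; $\nabla h_i(x_i)\in\mathbb R^{m_i\times p_i}$ has as columns the gradients of the components of $h_i$; $\|\cdot\|$ is the Euclidean norm; inequalities and $\max\{\cdot,0\}$ of vectors are componentwise; $\mathrm{dist}(w,\mathcal S)=\inf_{w'\in\mathcal S}\|w-w'\|$. $x_{<i}=(x_1,\ldots,x_{i-1})$, and similarly $x_{\ge i}$, etc. A point $z$ is a stationary point of $F$ if $0\in\partial F(z)$, where for $z\in\mathrm{dom}(F)$ the Fréchet subdifferential is $\partial F(z):=\{u:\liminf_{y\ne z,y\to z}\frac{F(y)-F(z)-\langle u,y-z\rangle}{\|y-z\|}\ge 0\}$, and $\partial F(z)=\emptyset$ for $z\notin\mathrm{dom}(F)$. Residual. $r_i(x_i,\lambda_i,\tilde x_i):=\max\{\langle x_i,x_i-\tilde x_i+\nabla h_i(x_i)\lambda_i\rangle,0\}+\|x_i-\tilde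 x_i+\nabla h_i(x_i)\lambda_i\|_\infty+\|\max\{h_i(x_i),0\}\|_\infty+\max\{-\langle\lambda_i,h_i(x_i)\rangle,0\}$. PALM-I. Inputs: $z^{(0)}\in\prod_i\mathbb R^{m_i}$, $\bar\varepsilon>0$, a nonnegative sequence $\{\varepsilon^{(k)}\}$ with $\varepsilon^{(k)}\le\bar\varepsilon$, $M_u\ge M_l>0$, and $\sigma_i^{(0)}\in[M_l,M_u]$. For $k=0,1,2,\ldots$ and, successively, $i=1,\ldots,n$: put $\tilde x_i^{(k)}:=x_i^{(k)}-\frac{1}{\sigma_i^{(k)}}\nabla_i f(x_{<i}^{(k+1)},x_{\ge i}^{(k)})$; choose $x_i^{(k+1)}\in\mathbb R^{m_i}$ (not necessarily in $\mathcal S_i$) for which there is $\lambda_i^{(k+1)}\in\mathbb R_+^{p_i}$ with $\sqrt{r_i(x_i^{(k+1)},\lambda_i^{(k+1)},\tilde x_i^{(k)})}\le\varepsilon^{(k)}$; choose $\sigma_i^{(k+1)}\in[M_l,M_u]$. This generates $z^{(k)}=(x_1^{(k)},\ldots,x_n^{(k)})$. The exact subproblem solutions along the run are $\bar x_i^{(k+1)}:=\arg\min_{x_i\in\mathcal S_i}\langle\nabla_i f(x_{<i}^{(k+1)},x_{\ge i}^{(k)}),x_i-x_i^{(k)}\rangle+\frac{\sigma_i^{(k)}}{2}\|x_i-x_i^{(k)}\|^2$, with $\bar z^{(k)}:=(\bar x_1^{(k)},\ldots,\bar x_n^{(k)})$ for $k\ge1$. Further notation. $\bar{\mathcal S}_i:=\{w\in\mathbb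 R^{m_i}:\mathrm{dist}(w,\mathcal S_i)\le\bar\varepsilon\}$; $\bar{\mathcal M}_i:=\sup_{z\in\prod_j\bar{\mathcal S}_j}\|\nabla_i f(z)\|$; $\tilde{\mathcal S}_i:=\{w\in\mathbb R^{m_i}:\mathrm{dist}(w,\bar{\mathcal S}_i)\le\bar{\mathcal M}_i/M_l\}$. $L:=\max_i L_i$; the algorithm is run with $M_l=\gamma L$ for some $\gamma>1$ and $M_u=M$ any scalar with $M\ge M_l$. *)

theory Defs
  imports "HOL-Analysis.Analysis"
begin

text \<open>
  The block sizes of \<open>R^(m 1) \<times> \<dots> \<times> R^(m n)\<close> vary with the block, so the product is flattened:
  a point \<open>z = (x 1, \<dots>, x n)\<close> is a vector of type \<open>real ^ 'd\<close>, where \<open>'d\<close> indexes all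
  \<open>m 1 + \<dots> + m n\<close> scalar coordinates, and \<open>blk :: 'd \<Rightarrow> nat\<close> tells in which of the blocks
  \<open>1, \<dots>, n\<close> a coordinate lies, so that block \<open>i\<close> has \<open>m i = card {j. blk j = i}\<close> coordinates.
  The factor \<open>R^(m i)\<close> is the coordinate subspace of the vectors that vanish outside block \<open>i\<close>;
  inner product, Euclidean norm and maximum norm of \<open>R^(m i)\<close> are those inherited from
  \<open>real ^ 'd\<close>.  Vectors of \<open>R^(p i)\<close> are functions on the index set \<open>{1..p i}\<close>, and
  \<open>h i c\<close> is the component with index \<open>c\<close> of the constraint map of block \<open>i\<close>, of which only
  the values on the subspace \<open>R^(m i)\<close> are used.
\<close>

definition block_space :: "('d \<Rightarrow> nat) \<Rightarrow> nat \<Rightarrow> (real ^ 'd) set" where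
  "block_space blk i = {w. \<forall>j. blk j \<noteq> i \<longrightarrow> w $ j = 0}"

definition block :: "('d \<Rightarrow> nat) \<Rightarrow> nat \<Rightarrow> real ^ 'd \<Rightarrow> real ^ 'd" where
  "block blk i z = (\<chi> j. if blk j = i then z $ j else 0)"

definition set_block :: "('d \<Rightarrow> nat) \<Rightarrow> nat \<Rightarrow> real ^ 'd \<Rightarrow> real ^ 'd \<Rightarrow> real ^ 'd" where
  "set_block blk i z w = (\<chi> j. if blk j = i then w $ j else z $ j)"

definition block_prod :: "('d \<Rightarrow> nat) \<Rightarrow> nat \<Rightarrow> (nat \<Rightarrow> (real ^ 'd) set) \<Rightarrow> (real ^ 'd) set" where
  "block_prod blk n A = {z. \<forall>i\<in>{1..n}. block blk i z \<in> A i}"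

text \<open>Gradient of a function on a linear subspace \<open>V\<close>; it is unique because it is required
  to lie in \<open>V\<close>.\<close>

definition grad_on :: "('a::euclidean_space) set \<Rightarrow> ('a \<Rightarrow> real) \<Rightarrow> 'a \<Rightarrow> 'a" where
  "grad_on V g x = (THE u. u \<in> V \<and> (g has_derivative (\<lambda>v. u \<bullet> v)) (at x within V))"

definition block_grad ::
  "('d::finite \<Rightarrow> nat) \<Rightarrow> nat \<Rightarrow> (real ^ 'd \<Rightarrow> real) \<Rightarrow> real ^ 'd \<Rightarrow> real ^ 'd" where
  "block_grad blk i f z =
     grad_on (block_space blk i) (\<lambda>w. f (set_block blk i z w)) (block blk i z)"

definition feasible ::
  "('d \<Rightarrow> nat) \<Rightarrow> (nat \<Rightarrow> nat) \<Rightarrow> (nat \<Rightarrow> nat \<Rightarrow> real ^ 'd \<Rightarrow> real) \<Rightarrow> nat \<Rightarrow> (real ^ 'd) set" where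
  "feasible blk p h i = {w \<in> block_space blk i. \<forall>c\<in>{1..p i}. h i c w \<le> 0}"

definition indicator_fun :: "'a set \<Rightarrow> 'a \<Rightarrow> ereal" where
  "indicator_fun A w = (if w \<in> A then 0 else \<infinity>)"

definition objective ::
  "('d \<Rightarrow> nat) \<Rightarrow> nat \<Rightarrow> (nat \<Rightarrow> nat) \<Rightarrow> (real ^ 'd \<Rightarrow> real) \<Rightarrow>
   (nat \<Rightarrow> nat \<Rightarrow> real ^ 'd \<Rightarrow> real) \<Rightarrow> real ^ 'd \<Rightarrow> ereal" where
  "objective blk n p f h z =
     ereal (f z) + (\<Sum>i\<in>{1..n}. indicator_fun (feasible blk p h i) (block blk i z))"

definition frechet_subdiff :: "('a::real_inner \<Rightarrow> ereal) \<Rightarrow> 'a \<Rightarrow> 'a set" where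
  "frechet_subdiff G z =
     (if G z < \<infinity>
      then {u. Liminf (at z) (\<lambda>y. (G y - G z - ereal (u \<bullet> (y - z))) / ereal (norm (y - z))) \<ge> 0}
      else {})"

definition stationary_point :: "('a::real_inner \<Rightarrow> ereal) \<Rightarrow> 'a \<Rightarrow> bool" where
  "stationary_point G z \<longleftrightarrow> 0 \<in> frechet_subdiff G z"

definition residual ::
  "('d::finite \<Rightarrow> nat) \<Rightarrow> (nat \<Rightarrow> nat) \<Rightarrow> (nat \<Rightarrow> nat \<Rightarrow> real ^ 'd \<Rightarrow> real) \<Rightarrow> nat \<Rightarrow>
   real ^ 'd \<Rightarrow> (nat \<Rightarrow> real) \<Rightarrow> real ^ 'd \<Rightarrow> real" where
  "residual blk p h i x lam xt =
     (let v = x - xt + (\<Sum>c\<in>{1..p i}. lam c *\<^sub>R grad_on (block_space blk i) (h i c) x)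
      in max (x \<bullet> v) 0 + infnorm v
         + Max ((\<lambda>c. \<bar>max (h i c x) 0\<bar>) ` {1..p i})
         + max (- (\<Sum>c\<in>{1..p i}. lam c * h i c x)) 0)"

text \<open>\<open>mixed blk i z' z\<close> takes the blocks before \<open>i\<close> from \<open>z'\<close> and the others from \<open>z\<close>.\<close>

definition mixed :: "('d \<Rightarrow> nat) \<Rightarrow> nat \<Rightarrow> real ^ 'd \<Rightarrow> real ^ 'd \<Rightarrow> real ^ 'd" where
  "mixed blk i z' z = (\<chi> j. if blk j < i then z' $ j else z $ j)"

definition partial_grad ::
  "('d::finite \<Rightarrow> nat) \<Rightarrow> (real ^ 'd \<Rightarrow> real) \<Rightarrow> (nat \<Rightarrow> real ^ 'd) \<Rightarrow> nat \<Rightarrow> nat \<Rightarrow> real ^ 'd" where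
  "partial_grad blk f z k i = block_grad blk i f (mixed blk i (z (Suc k)) (z k))"

definition palm_I ::
  "('d::finite \<Rightarrow> nat) \<Rightarrow> nat \<Rightarrow> (nat \<Rightarrow> nat) \<Rightarrow> (real ^ 'd \<Rightarrow> real) \<Rightarrow>
   (nat \<Rightarrow> nat \<Rightarrow> real ^ 'd \<Rightarrow> real) \<Rightarrow> real \<Rightarrow> (nat \<Rightarrow> real) \<Rightarrow> real \<Rightarrow> real \<Rightarrow>
   (nat \<Rightarrow> nat \<Rightarrow> real) \<Rightarrow> (nat \<Rightarrow> real ^ 'd) \<Rightarrow> bool" where
  "palm_I blk n p f h epsbar eps Ml Mu sig z \<longleftrightarrow>
     0 < epsbar \<and> (\<forall>k. 0 \<le> eps k \<and> eps k \<le> epsbar) \<and> 0 < Ml \<and> Ml \<le> Mu \<and>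
     (\<forall>k. \<forall>i\<in>{1..n}. sig k i \<in> {Ml..Mu}) \<and>
     (\<forall>k. \<forall>i\<in>{1..n}.
        let xt = block blk i (z k) - (1 / sig k i) *\<^sub>R partial_grad blk f z k i
        in \<exists>lam. (\<forall>c\<in>{1..p i}. 0 \<le> lam c) \<and>
             sqrt (residual blk p h i (block blk i (z (Suc k))) lam xt) \<le> eps k)"

definition exact_solutions ::
  "('d::finite \<Rightarrow> nat) \<Rightarrow> nat \<Rightarrow> (nat \<Rightarrow> nat) \<Rightarrow> (real ^ 'd \<Rightarrow> real) \<Rightarrow>
   (nat \<Rightarrow> nat \<Rightarrow> real ^ 'd \<Rightarrow> real) \<Rightarrow> (nat \<Rightarrow> nat \<Rightarrow> real) \<Rightarrow>
   (nat \<Rightarrow> real ^ 'd) \<Rightarrow> (nat \<Rightarrow> real ^ 'd) \<Rightarrow> bool" where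
  "exact_solutions blk n p f h sig z zbar \<longleftrightarrow>
     (\<forall>k. \<forall>i\<in>{1..n}.
        is_arg_min
          (\<lambda>w. partial_grad blk f z k i \<bullet> (w - block blk i (z k))
               + sig k i / 2 * (norm (w - block blk i (z k)))\<^sup>2)
          (\<lambda>w. w \<in> feasible blk p h i)
          (block blk i (zbar (Suc k))))"

text \<open>The feasible sets are nonempty whenever exact subproblem solutions exist, so the
  convention \<open>infdist w {} = 0\<close> plays no role below.  If the partial gradient is Lipschitz on the
  product of the sets \<open>S_bar\<close> and the feasible sets are compact, the supremum in \<open>M_bar\<close>
  is over a nonempty bounded set.\<close>

definition S_bar ::
  "('d::finite \<Rightarrow> nat) \<Rightarrow> (nat \<Rightarrow> nat) \<Rightarrow> (nat \<Rightarrow> nat \<Rightarrow> real ^ 'd \<Rightarrow> real) \<Rightarrow> real \<Rightarrow> nat \<Rightarrow>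
   (real ^ 'd) set" where
  "S_bar blk p h epsbar i =
     {w \<in> block_space blk i. infdist w (feasible blk p h i) \<le> epsbar}"

definition M_bar ::
  "('d::finite \<Rightarrow> nat) \<Rightarrow> nat \<Rightarrow> (nat \<Rightarrow> nat) \<Rightarrow> (real ^ 'd \<Rightarrow> real) \<Rightarrow>
   (nat \<Rightarrow> nat \<Rightarrow> real ^ 'd \<Rightarrow> real) \<Rightarrow> real \<Rightarrow> nat \<Rightarrow> real" where
  "M_bar blk n p f h epsbar i =
     (SUP z\<in>block_prod blk n (S_bar blk p h epsbar). norm (block_grad blk i f z))"

definition S_tilde ::
  "('d::finite \<Rightarrow> nat) \<Rightarrow> nat \<Rightarrow> (nat \<Rightarrow> nat) \<Rightarrow> (real ^ 'd \<Rightarrow> real) \<Rightarrow>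
   (nat \<Rightarrow> nat \<Rightarrow> real ^ 'd \<Rightarrow> real) \<Rightarrow> real \<Rightarrow> real \<Rightarrow> nat \<Rightarrow> (real ^ 'd) set" where
  "S_tilde blk n p f h epsbar Ml i =
     {w \<in> block_space blk i.
        infdist w (S_bar blk p h epsbar i) \<le> M_bar blk n p f h epsbar i / Ml}"

text \<open>As usual for constraint systems, a linear constraint map is one with affine components.\<close>

definition linear_constraints ::
  "('d::finite \<Rightarrow> nat) \<Rightarrow> (nat \<Rightarrow> nat) \<Rightarrow> (nat \<Rightarrow> nat \<Rightarrow> real ^ 'd \<Rightarrow> real) \<Rightarrow> nat \<Rightarrow> bool" where
  "linear_constraints blk p h i \<longleftrightarrow>
     (\<forall>c\<in>{1..p i}. \<exists>a b. \<forall>w\<in>block_space blk i. h i c w = a \<bullet> w + b)"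

definition slater ::
  "('d \<Rightarrow> nat) \<Rightarrow> (nat \<Rightarrow> nat) \<Rightarrow> (nat \<Rightarrow> nat \<Rightarrow> real ^ 'd \<Rightarrow> real) \<Rightarrow> nat \<Rightarrow> bool" where
  "slater blk p h i \<longleftrightarrow> (\<exists>w\<in>block_space blk i. \<forall>c\<in>{1..p i}. h i c w < 0)"

definition accumulation_points :: "(nat \<Rightarrow> 'a::topological_space) \<Rightarrow> 'a set" where
  "accumulation_points z =
     {w. \<exists>K. infinite K \<and> (z \<longlongrightarrow> w) (inf sequentially (principal K))}"

end

theory Submission
  imports Defs
begin

text \<open>
  A step of the algorithm replaces block \<open>i\<close> by an inexact projection of a gradient step on the
  feasible set \<open>S i\<close>. A projection is characterised by the inequality
  \<open>(xt - x') \<bullet> (y - x') \<le> 0\<close> for all feasible \<open>y\<close>. Convexity of the constraints shows that a point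
  with residual at most \<open>eps\<^sup>2\<close> satisfies it with a multiple of \<open>eps\<^sup>2\<close> on the right
  (\<open>residual_variational_inequality\<close>), and the error bound shows that such a point has distance of order
  \<open>eps\<^sup>2\<close> from \<open>S i\<close>. Both errors are summable, and they are all that the convergence proof uses of
  the residual; the locale \<open>inexact_block_prox\<close> isolates this situation.

  The starting point is arbitrary and the gradient is Lipschitz only near the feasible set. However,
  every later iterate violates the constraints by at most \<open>eps\<^sup>2\<close>, and for a convex system with a compact
  solution set a small violation forces a small distance (\<open>infdist_le_of_small_violation\<close>). So the
  iterates eventually stay in a compact convex product on which the gradient is Lipschitz, and an
  initial segment does not affect accumulation points.

  There, the descent inequality along one block, summed over the blocks, gives
  \<open>f (z (Suc k)) \<le> f (z k) - Ml / 2 * (norm (z (Suc k) - z k))\<^sup>2 + (summable error)\<close>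
  (\<open>sufficient_decrease\<close>). As \<open>f\<close> is bounded below on the compact product, the values \<open>f (z k)\<close> converge,
  which makes \<open>f\<close> constant on the set of accumulation points, and the steps \<open>z (Suc k) - z k\<close> tend to
  \<open>0\<close>. By Ostrowski's theorem (\<open>connected_accumulation_points\<close>) the accumulation points of such a
  bounded sequence form a compact connected set. In the limit the approximate projection inequality
  becomes \<open>0 \<le> block_grad blk i f w \<bullet> (y - block blk i w)\<close> for all \<open>y\<close> in \<open>S i\<close>, i.e. stationarity.
  Finally the exact subproblem solutions differ from the iterates by a null sequence
  (\<open>exact_solutions_close\<close>), hence they also approach the set of accumulation points.
\<close>

section \<open>Gradients on linear subspaces\<close>

text \<open>
  Two representing vectors in \<open>V\<close> are compared along the line through \<open>x\<close> in the direction of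
  their difference: there the ordinary one-dimensional derivative is unique.
\<close>

lemma subspace_derivative_unique:
  fixes g :: "'a::euclidean_space \<Rightarrow> real"
  assumes V: "subspace V" and x: "x \<in> V" and u: "u \<in> V" "u' \<in> V"
    and du: "(g has_derivative (\<lambda>v. u \<bullet> v)) (at x within V)"
    and du': "(g has_derivative (\<lambda>v. u' \<bullet> v)) (at x within V)"
  shows "u = u'"
proof -
  define d where "d = u - u'"
  have dV: "d \<in> V" unfolding d_def using V u by (rule subspace_diff)
  have line: "(\<lambda>t. x + t *\<^sub>R d) ` UNIV \<subseteq> V"
    using V x dV by (auto intro: subspace_add subspace_scale)
  have A: "((\<lambda>t::real. g (x + t *\<^sub>R d)) has_derivative (\<lambda>t. a \<bullet> (t *\<^sub>R d))) (at 0)"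
    if "(g has_derivative (\<lambda>v. a \<bullet> v)) (at x within V)" for a
  proof -
    have 1: "((\<lambda>t::real. x + t *\<^sub>R d) has_derivative (\<lambda>t. t *\<^sub>R d)) (at 0)"
      by (auto intro!: derivative_eq_intros)
    have 2: "(g has_derivative (\<lambda>v. a \<bullet> v)) (at (x + 0 *\<^sub>R d) within range (\<lambda>t. x + t *\<^sub>R d))"
      using has_derivative_subset[OF that line] by simp
    show ?thesis using has_derivative_in_compose[OF 1 2] by simp
  qed
  have "(\<lambda>t::real. u \<bullet> (t *\<^sub>R d)) = (\<lambda>t. u' \<bullet> (t *\<^sub>R d))"
    using A[OF du] A[OF du'] by (rule has_derivative_unique)
  from fun_cong[OF this, of 1] have "d \<bullet> d = 0"
    by (simp add: d_def inner_diff_left)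
  then show ?thesis by (simp add: d_def)
qed

lemma grad_on_eqI:
  fixes g :: "'a::euclidean_space \<Rightarrow> real"
  assumes "subspace V" "x \<in> V" "u \<in> V" "(g has_derivative (\<lambda>v. u \<bullet> v)) (at x within V)"
  shows "grad_on V g x = u"
  unfolding grad_on_def
  using assms by (intro the_equality) (auto intro: subspace_derivative_unique)

lemma grad_on_has_derivative:
  fixes g :: "'a::euclidean_space \<Rightarrow> real"
  assumes V: "subspace V" and x: "x \<in> V" and g: "g differentiable_on V"
  shows "grad_on V g x \<in> V"
    and "(g has_derivative (\<lambda>v. grad_on V g x \<bullet> v)) (at x within V)"
proof -
  obtain D where D: "(g has_derivative D) (at x within V)"
    using g x by (auto simp: differentiable_on_def differentiable_def)
  then have lin: "linear D" by (rule has_derivative_linear)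
  have adj: "a \<bullet> adjoint D 1 = D a" for a using adjoint_works[OF lin, of a 1] by simp
  \<comment> \<open>The representing vector of \<open>D\<close> on the whole space need not lie in \<open>V\<close>; its orthogonal
    projection does and represents \<open>D\<close> on \<open>V\<close>.\<close>
  obtain u w where u: "u \<in> V" and w: "\<And>a. a \<in> V \<Longrightarrow> orthogonal w a" and uw: "adjoint D 1 = u + w"
    using orthogonal_subspace_decomp_exists[of V "adjoint D 1"] V
    by (metis span_eq_iff)
  have on_V: "u \<bullet> a = D a" if "a \<in> V" for a
    using w[OF that] adj[of a] by (simp add: uw orthogonal_def inner_commute inner_add_right)
  have "(g has_derivative (\<lambda>v. u \<bullet> v)) (at x within V)"
    using D unfolding has_derivative_within
  proof (elim conjE, intro conjI)
    show "bounded_linear ((\<bullet>) u)" by (rule bounded_linear_inner_right)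
    assume *: "((\<lambda>y. (1 / norm (y - x)) *\<^sub>R (g y - (g x + D (y - x)))) \<longlongrightarrow> 0) (at x within V)"
    show "((\<lambda>y. (1 / norm (y - x)) *\<^sub>R (g y - (g x + u \<bullet> (y - x)))) \<longlongrightarrow> 0) (at x within V)"
      by (rule Lim_transform_within[OF * zero_less_one]) (simp add: on_V subspace_diff[OF V _ x])
  qed
  with grad_on_eqI[OF V x u this] u
  show "grad_on V g x \<in> V" "(g has_derivative (\<lambda>v. grad_on V g x \<bullet> v)) (at x within V)"
    by simp_all
qed

text \<open>
  The one-dimensional tangent inequality, applied to the restriction of \<open>g\<close> to the line through \<open>x\<close>
  and \<open>y\<close>, which stays in \<open>V\<close>.
\<close>

lemma convex_on_subspace_gradient_inequality:
  fixes g :: "'a::euclidean_space \<Rightarrow> real"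
  assumes V: "subspace V" and g: "convex_on V g" "g differentiable_on V"
    and x: "x \<in> V" and y: "y \<in> V"
  shows "grad_on V g x \<bullet> (y - x) \<le> g y - g x"
proof -
  define d where "d = y - x"
  have dV: "d \<in> V" unfolding d_def using V y x by (rule subspace_diff)
  have inV: "x + t *\<^sub>R d \<in> V" for t
    using V x dV by (intro subspace_add subspace_scale)
  have conv: "convex_on UNIV (\<lambda>t::real. g (x + t *\<^sub>R d))"
  proof (rule convex_onI)
    fix t a b :: real assume t: "0 < t" "t < 1"
    have eq: "x + ((1 - t) *\<^sub>R a + t *\<^sub>R b) *\<^sub>R d
        = (1 - t) *\<^sub>R (x + a *\<^sub>R d) + t *\<^sub>R (x + b *\<^sub>R d)"
      by (simp add: algebra_simps)
    show "g (x + ((1 - t) *\<^sub>R a + t *\<^sub>R b) *\<^sub>R d)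
        \<le> (1 - t) * g (x + a *\<^sub>R d) + t * g (x + b *\<^sub>R d)"
      unfolding eq using convex_onD[OF g(1), of t] t inV by simp
  qed simp
  have 1: "((\<lambda>t::real. x + t *\<^sub>R d) has_derivative (\<lambda>t. t *\<^sub>R d)) (at 0)"
    by (auto intro!: derivative_eq_intros)
  have 2: "(g has_derivative (\<lambda>v. grad_on V g x \<bullet> v))
      (at (x + 0 *\<^sub>R d) within range (\<lambda>t. x + t *\<^sub>R d))"
    using has_derivative_subset[OF grad_on_has_derivative(2)[OF V x g(2)], of "range (\<lambda>t. x + t *\<^sub>R d)"] inV
    by (simp add: image_subset_iff)
  have "((\<lambda>t::real. g (x + t *\<^sub>R d)) has_field_derivative grad_on V g x \<bullet> d) (at 0)"
    using has_derivative_in_compose[OF 1 2]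
    by (simp add: has_field_derivative_def mult.commute[of _ "grad_on V g x \<bullet> d"])
  then show ?thesis
    using convex_on_imp_above_tangent[OF conv, of 0 1 "grad_on V g x \<bullet> d"]
    by (simp add: d_def)
qed

section \<open>Blocks of coordinates\<close>

lemma subspace_block_space: "subspace (block_space blk i)"
  by (auto simp: subspace_def block_space_def)

lemma linear_block: "linear (block blk i)"
  by (rule linearI) (auto simp: block_def vec_eq_iff)

lemmas block_add = linear_add[OF linear_block]
  and block_diff = linear_diff[OF linear_block]
  and block_scaleR = linear_scale[OF linear_block]

lemma block_in_block_space: "block blk i z \<in> block_space blk i"
  by (simp add: block_def block_space_def)

lemma block_block: "block blk i (block blk j z) = (if i = j then block blk i z else 0)"
  by (auto simp: block_def vec_eq_iff)

lemma inner_block_swap: "block blk i x \<bullet> y = x \<bullet> block blk i y"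
  unfolding inner_vec_def block_def by (rule sum.cong) auto

lemma inner_block_block: "block blk i x \<bullet> block blk i y = x \<bullet> block blk i y"
  by (simp add: inner_block_swap block_block)

lemma sum_blocks:
  assumes "\<forall>j. blk j \<in> {1..n}"
  shows "(\<Sum>i\<in>{1..n}. block blk i z) = z"
  using assms by (simp add: vec_eq_iff block_def)

lemma sum_norm_blocks:
  fixes blk :: "'d::finite \<Rightarrow> nat"
  assumes "\<forall>j. blk j \<in> {1..n}"
  shows "(\<Sum>i\<in>{1..n}. (norm (block blk i z))\<^sup>2) = (norm z)\<^sup>2"
proof -
  have "(\<Sum>i\<in>{1..n}. (norm (block blk i z))\<^sup>2) = z \<bullet> (\<Sum>i\<in>{1..n}. block blk i z)"
    by (simp add: power2_norm_eq_inner inner_block_block inner_sum_right)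
  then show ?thesis unfolding sum_blocks[OF assms] by (simp add: power2_norm_eq_inner)
qed

lemma norm_block_le: "norm (block blk i z) \<le> norm z"
  by (rule norm_le_componentwise_cart) (simp add: block_def)

lemma bounded_linear_block: "bounded_linear (block blk i)"
  for blk :: "'d::finite \<Rightarrow> nat"
  by (rule linear_conv_bounded_linear[THEN iffD1, OF linear_block])

lemmas tendsto_block = bounded_linear.tendsto[OF bounded_linear_block]

lemma block_mixed:
  "block blk j (mixed blk i z' z) = (if j < i then block blk j z' else block blk j z)"
  by (auto simp: block_def mixed_def vec_eq_iff)

lemma mixed_Suc: "mixed blk (Suc i) z' z = mixed blk i z' z + (block blk i z' - block blk i z)"
  by (auto simp: block_def mixed_def vec_eq_iff)

lemma mixed_first:
  assumes "\<forall>j. blk j \<in> {1..n}"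
  shows "mixed blk 1 z' z = z"
proof -
  have "1 \<le> blk j" for j using assms by (metis atLeastAtMost_iff)
  then have "\<not> blk j < 1" for j by (meson not_le)
  then show ?thesis
    unfolding mixed_def vec_eq_iff vec_lambda_beta by (intro allI if_not_P) blast
qed

lemma mixed_last: "\<forall>j. blk j \<in> {1..n} \<Longrightarrow> mixed blk (Suc n) z' z = z'"
  by (simp add: mixed_def vec_eq_iff less_Suc_eq_le)

lemma norm_mixed_diff_le: "norm (mixed blk i z' z - z) \<le> norm (z' - z)"
  by (rule norm_le_componentwise_cart) (simp add: mixed_def)

lemma set_block_eq: "set_block blk i z w = z - block blk i z + block blk i w"
  by (auto simp: set_block_def block_def vec_eq_iff)

lemma mixed_in_block_prod:
  assumes "z \<in> block_prod blk n A" "z' \<in> block_prod blk n A"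
  shows "mixed blk i z' z \<in> block_prod blk n A"
  using assms by (auto simp: block_prod_def block_mixed)

lemma convex_block_prod:
  assumes "\<And>i. i \<in> {1..n} \<Longrightarrow> convex (A i)"
  shows "convex (block_prod blk n A)"
proof (rule convexI)
  fix x y and u v :: real
  assume "x \<in> block_prod blk n A" "y \<in> block_prod blk n A" and uv: "0 \<le> u" "0 \<le> v" "u + v = 1"
  then show "u *\<^sub>R x + v *\<^sub>R y \<in> block_prod blk n A"
    using convexD[OF assms _ _ uv] by (simp add: block_prod_def block_add block_scaleR)
qed

lemma compact_block_prod:
  fixes blk :: "'d::finite \<Rightarrow> nat"
  assumes blk: "\<forall>j. blk j \<in> {1..n}" and A: "\<And>i. i \<in> {1..n} \<Longrightarrow> compact (A i)"
  shows "compact (block_prod blk n A)"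
  unfolding compact_eq_bounded_closed
proof
  have "\<forall>i\<in>{1..n}. \<exists>b. \<forall>x\<in>A i. norm x \<le> b"
    using compact_imp_bounded[OF A] by (simp add: bounded_iff)
  then obtain b where b: "\<And>i x. i \<in> {1..n} \<Longrightarrow> x \<in> A i \<Longrightarrow> norm x \<le> b i"
    by (elim bchoice[THEN exE]) blast
  have "norm z \<le> (\<Sum>i\<in>{1..n}. b i)" if "z \<in> block_prod blk n A" for z
  proof -
    have "norm z \<le> (\<Sum>i\<in>{1..n}. norm (block blk i z))"
      using norm_sum[of "\<lambda>i. block blk i z" "{1..n}"] sum_blocks[OF blk, of z] by simp
    also have "\<dots> \<le> (\<Sum>i\<in>{1..n}. b i)"
      using that b by (intro sum_mono) (auto simp: block_prod_def)
    finally show ?thesis .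
  qed
  then show "bounded (block_prod blk n A)" by (auto simp: bounded_iff)
  have "block_prod blk n A = (\<Inter>i\<in>{1..n}. block blk i -` A i)"
    by (auto simp: block_prod_def)
  also have "closed \<dots>"
  proof (intro closed_INT ballI)
    fix i assume i: "i \<in> {1..n}"
    show "closed (block blk i -` A i)"
      by (intro continuous_closed_vimage[OF compact_imp_closed[OF A[OF i]]] linear_continuous_at
          bounded_linear_block)
  qed
  finally show "closed (block_prod blk n A)" .
qed

text \<open>
  For a differentiable function the partial gradient is the block of the full gradient. This lets
  the descent argument work with one gradient, while the Lipschitz bound concerns its blocks.
\<close>

lemma block_grad_eq_block:
  fixes blk :: "'d::finite \<Rightarrow> nat" and f :: "real ^ 'd \<Rightarrow> real"
  assumes f: "(f has_derivative (\<lambda>v. G \<bullet> v)) (at z)"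
  shows "block_grad blk i f z = block blk i G"
  unfolding block_grad_def
proof (rule grad_on_eqI[OF subspace_block_space block_in_block_space block_in_block_space])
  let ?b = "block blk i z" and ?V = "block_space blk i"
  have eq: "set_block blk i z = (\<lambda>w. z - ?b + block blk i w)"
    by (rule ext) (rule set_block_eq)
  have 1: "(set_block blk i z has_derivative block blk i) (at ?b within ?V)"
    unfolding eq by (auto intro!: derivative_eq_intros bounded_linear_imp_has_derivative bounded_linear_block)
  have "set_block blk i z ?b = z" by (simp add: set_block_eq block_block)
  then have 2: "(f has_derivative (\<lambda>v. G \<bullet> v)) (at (set_block blk i z ?b) within set_block blk i z ` ?V)"
    using f by (auto intro: has_derivative_at_withinI)
  show "((\<lambda>w. f (set_block blk i z w)) has_derivative (\<lambda>v. block blk i G \<bullet> v)) (at ?b within ?V)"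
    using has_derivative_in_compose[OF 1 2] by (simp add: inner_block_swap)
qed

lemma has_derivative_grad_on_UNIV:
  fixes f :: "'a::euclidean_space \<Rightarrow> real"
  assumes "f differentiable_on UNIV"
  shows "(f has_derivative (\<lambda>v. grad_on UNIV f z \<bullet> v)) (at z)"
  using grad_on_has_derivative(2)[OF subspace_UNIV UNIV_I assms] .

lemma block_grad_eq_block_grad_on:
  fixes f :: "real ^ 'd::finite \<Rightarrow> real"
  assumes "f differentiable_on UNIV"
  shows "block_grad blk i f z = block blk i (grad_on UNIV f z)"
  by (rule block_grad_eq_block[OF has_derivative_grad_on_UNIV[OF assms]])

section \<open>Accumulation points of sequences with vanishing steps\<close>

lemma accumulation_points_subseq:
  fixes z :: "nat \<Rightarrow> 'a::topological_space"
  shows "w \<in> accumulation_points z \<longleftrightarrow> (\<exists>r::nat \<Rightarrow> nat. strict_mono r \<and> (z \<circ> r) \<longlonglongrightarrow> w)"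
proof
  assume "w \<in> accumulation_points z"
  then obtain K where K: "infinite K" and lim: "(z \<longlongrightarrow> w) (inf sequentially (principal K))"
    by (auto simp: accumulation_points_def)
  have "filterlim (enumerate K) (inf sequentially (principal K)) sequentially"
    unfolding filterlim_inf filterlim_principal
    using K by (auto intro!: filterlim_subseq strict_mono_enumerate simp: enumerate_in_set)
  then have "(z \<circ> enumerate K) \<longlonglongrightarrow> w"
    using filterlim_compose[OF lim] by (simp add: o_def)
  then show "\<exists>r::nat \<Rightarrow> nat. strict_mono r \<and> (z \<circ> r) \<longlonglongrightarrow> w"
    using strict_mono_enumerate[OF K] by blast
next
  assume "\<exists>r::nat \<Rightarrow> nat. strict_mono r \<and> (z \<circ> r) \<longlonglongrightarrow> w"
  then obtain r :: "nat \<Rightarrow> nat" where r: "strict_mono r" and lim: "(z \<circ> r) \<longlonglongrightarrow> w" by blast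
  have "(z \<longlongrightarrow> w) (inf sequentially (principal (range r)))"
    unfolding tendsto_def eventually_inf_principal
  proof (intro allI impI)
    fix S assume "open S" "w \<in> S"
    then have "eventually (\<lambda>j. z (r j) \<in> S) sequentially"
      using lim by (auto simp: tendsto_def o_def)
    then obtain N where N: "\<And>j. N \<le> j \<Longrightarrow> z (r j) \<in> S"
      by (auto simp: eventually_sequentially)
    show "\<forall>\<^sub>F k in sequentially. k \<in> range r \<longrightarrow> z k \<in> S"
      unfolding eventually_sequentially
    proof (intro exI[of _ "r N"] allI impI)
      fix k assume "r N \<le> k" "k \<in> range r"
      then obtain j where "k = r j" "r N \<le> r j" by auto
      then show "z k \<in> S" using N r by (simp add: strict_mono_less_eq)
    qed
  qed
  moreover have "infinite (range r)"
    using r by (simp add: range_inj_infinite strict_mono_imp_inj_on)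
  ultimately show "w \<in> accumulation_points z"
    by (auto simp: accumulation_points_def)
qed

text \<open>
  The iterates are controlled only from some index on; this is what allows an initial segment to be
  discarded.
\<close>

lemma accumulation_points_shift:
  "accumulation_points (\<lambda>k. z (k + N)) = accumulation_points z"
proof (intro set_eqI iffI)
  fix w assume "w \<in> accumulation_points (\<lambda>k. z (k + N))"
  then obtain r :: "nat \<Rightarrow> nat" where "strict_mono r" "(\<lambda>j. z (r j + N)) \<longlonglongrightarrow> w"
    by (auto simp: accumulation_points_subseq o_def)
  then show "w \<in> accumulation_points z"
    unfolding accumulation_points_subseq
    by (intro exI[of _ "\<lambda>j. r j + N"]) (auto simp: strict_mono_def o_def)
next
  fix w assume "w \<in> accumulation_points z"
  then obtain r :: "nat \<Rightarrow> nat" where r: "strict_mono r" and lim: "(z \<circ> r) \<longlonglongrightarrow> w"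
    by (auto simp: accumulation_points_subseq)
  have ge: "N \<le> r (j + N)" for j
    using seq_suble[OF r, of "j + N"] by simp
  have "strict_mono (\<lambda>j. r (j + N) - N)"
    using r ge by (auto simp: strict_mono_def intro!: diff_less_mono)
  moreover have "(\<lambda>j. z (r (j + N) - N + N)) \<longlonglongrightarrow> w"
    using LIMSEQ_ignore_initial_segment[OF lim, of N] ge by (simp add: o_def)
  ultimately show "w \<in> accumulation_points (\<lambda>k. z (k + N))"
    unfolding accumulation_points_subseq by (auto simp: o_def)
qed

text \<open>
  Choose increasing indices at which \<open>P j\<close> holds and extract a convergent subsequence. With \<open>P j\<close> of
  the form \<open>\<dots> < 1 / (j + 1)\<close>, for a continuous left-hand side, the limit satisfies the limiting
  condition.
\<close>

lemma frequently_subseq_limit: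
  fixes z :: "nat \<Rightarrow> 'a::heine_borel"
  assumes z: "bounded (range z)" and P: "\<And>j. \<exists>\<^sub>F k in sequentially. P j k"
  shows "\<exists>r w. (z \<circ> r) \<longlonglongrightarrow> w \<and> w \<in> accumulation_points z \<and> (\<forall>j. \<exists>i\<ge>j. P i (r j))"
proof -
  have P': "\<exists>k>N. P j k" for j N
    using P[of j] unfolding frequently_sequentially by (meson Suc_le_eq)
  have "\<exists>s. \<forall>j. P j (s j) \<and> s j < s (Suc j)"
    using P' by (intro dependent_nat_choice) auto
  then obtain s where s: "\<And>j. P j (s j)" "\<And>j. s j < s (Suc j)" by blast
  have sm: "strict_mono s" using s(2) by (rule strict_monoI_Suc)
  have "bounded (range (z \<circ> s))"
    using z by (rule bounded_subset) auto
  then obtain w q where q: "strict_mono q" and lim: "((z \<circ> s) \<circ> q) \<longlonglongrightarrow> w"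
    using bounded_imp_convergent_subsequence[of "z \<circ> s"] by auto
  have r: "strict_mono (s \<circ> q)" using sm q by (rule strict_mono_o)
  have lim': "(z \<circ> (s \<circ> q)) \<longlonglongrightarrow> w" using lim by (simp add: o_assoc)
  have "w \<in> accumulation_points z"
    using r lim' unfolding accumulation_points_subseq by blast
  moreover have "\<exists>i\<ge>j. P i ((s \<circ> q) j)" for j
    using s(1)[of "q j"] seq_suble[OF q, of j] by auto
  ultimately show ?thesis using lim' by blast
qed

lemma accumulation_points_nonempty:
  fixes z :: "nat \<Rightarrow> 'a::heine_borel"
  assumes "bounded (range z)"
  shows "accumulation_points z \<noteq> {}"
proof -
  obtain w r where "strict_mono r" "(z \<circ> r) \<longlonglongrightarrow> w"
    using bounded_imp_convergent_subsequence[OF assms] by auto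
  then have "w \<in> accumulation_points z"
    by (intro accumulation_points_subseq[THEN iffD2] exI[of _ r] conjI)
  then show ?thesis by blast
qed

lemma accumulation_points_frequently:
  fixes z :: "nat \<Rightarrow> 'a::heine_borel"
  assumes z: "bounded (range z)"
  shows "w \<in> accumulation_points z \<longleftrightarrow> (\<forall>e>0. \<exists>\<^sub>F k in sequentially. dist (z k) w < e)"
proof (intro iffI allI impI)
  fix e :: real assume "w \<in> accumulation_points z" "0 < e"
  then obtain r :: "nat \<Rightarrow> nat" where r: "strict_mono r" and lim: "(z \<circ> r) \<longlonglongrightarrow> w"
    unfolding accumulation_points_subseq by blast
  have "\<forall>\<^sub>F j in sequentially. dist (z (r j)) w < e"
    using tendstoD[OF lim \<open>0 < e\<close>] by simp
  then obtain N where N: "\<And>j. N \<le> j \<Longrightarrow> dist (z (r j)) w < e"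
    by (auto simp: eventually_sequentially)
  show "\<exists>\<^sub>F k in sequentially. dist (z k) w < e"
    unfolding frequently_sequentially
  proof
    fix M
    have "M \<le> r (max M N)" using seq_suble[OF r, of "max M N"] by simp
    then show "\<exists>k\<ge>M. dist (z k) w < e" using N[of "max M N"] by auto
  qed
next
  assume "\<forall>e>0. \<exists>\<^sub>F k in sequentially. dist (z k) w < e"
  then have "\<exists>\<^sub>F k in sequentially. dist (z k) w < 1 / real (Suc j)" for j
    by simp
  from frequently_subseq_limit[where P = "\<lambda>j k. dist (z k) w < 1 / real (Suc j)", OF z this]
  obtain r v where r: "(z \<circ> r) \<longlonglongrightarrow> v" "v \<in> accumulation_points z"
    and near: "\<forall>j. \<exists>i\<ge>j. dist (z (r j)) w < 1 / real (Suc i)" by (elim exE conjE)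
  have "dist (z (r j)) w \<le> 1 / real (Suc j)" for j
  proof -
    obtain i where "j \<le> i" "dist (z (r j)) w < 1 / real (Suc i)" using near by blast
    moreover have "1 / real (Suc i) \<le> 1 / real (Suc j)"
      using \<open>j \<le> i\<close> by (simp add: frac_le)
    ultimately show ?thesis by simp
  qed
  then have "(\<lambda>j. dist (z (r j)) w) \<longlonglongrightarrow> 0"
    by (intro tendsto_sandwich[OF _ _ tendsto_const LIMSEQ_inverse_real_of_nat])
      (auto simp: inverse_eq_divide)
  then have "(z \<circ> r) \<longlonglongrightarrow> w" unfolding o_def by (rule tendsto_dist_iff[THEN iffD2])
  with r show "w \<in> accumulation_points z" using LIMSEQ_unique by blast
qed

lemma compact_accumulation_points:
  fixes z :: "nat \<Rightarrow> 'a::heine_borel"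
  assumes z: "bounded (range z)"
  shows "compact (accumulation_points z)"
  unfolding compact_eq_bounded_closed
proof
  have sub: "accumulation_points z \<subseteq> closure (range z)"
  proof
    fix w assume "w \<in> accumulation_points z"
    then obtain r :: "nat \<Rightarrow> nat" where "(z \<circ> r) \<longlonglongrightarrow> w"
      unfolding accumulation_points_subseq by blast
    then show "w \<in> closure (range z)"
      unfolding closure_sequential by (intro exI[of _ "z \<circ> r"]) simp
  qed
  show "bounded (accumulation_points z)"
    using bounded_closure[OF z] sub by (rule bounded_subset)
  show "closed (accumulation_points z)"
    unfolding closure_subset_eq[symmetric]
  proof
    fix x assume "x \<in> closure (accumulation_points z)"
    then have x: "\<forall>e>0. \<exists>y\<in>accumulation_points z. dist y x < e"
      by (simp only: closure_approachable)
    show "x \<in> accumulation_points z"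
      unfolding accumulation_points_frequently[OF z]
    proof (intro allI impI)
      fix e :: real assume e: "0 < e"
      then obtain y where y: "y \<in> accumulation_points z" "dist y x < e / 2"
        using x by (meson half_gt_zero)
      have "\<exists>\<^sub>F k in sequentially. dist (z k) y < e / 2"
        using y(1)[unfolded accumulation_points_frequently[OF z]] half_gt_zero[OF e] by blast
      then show "\<exists>\<^sub>F k in sequentially. dist (z k) x < e"
        by (rule frequently_elim1) (use y(2) dist_triangle_half_r dist_commute in metis)
    qed
  qed
qed

lemma infdist_accumulation_points_tendsto_0:
  fixes z :: "nat \<Rightarrow> 'a::heine_borel"
  assumes z: "bounded (range z)"
  shows "(\<lambda>k. infdist (z k) (accumulation_points z)) \<longlonglongrightarrow> 0"
proof (rule ccontr)
  assume "\<not> ?thesis"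
  then obtain e where e: "0 < e" and
    often: "\<exists>\<^sub>F k in sequentially. e \<le> infdist (z k) (accumulation_points z)"
    by (auto simp: tendsto_iff infdist_nonneg frequently_def not_le)
  from frequently_subseq_limit[where P = "\<lambda>_ k. e \<le> infdist (z k) (accumulation_points z)", OF z often]
  obtain r w where lim: "(z \<circ> r) \<longlonglongrightarrow> w" and w: "w \<in> accumulation_points z"
    and "\<forall>j. \<exists>i\<ge>j. e \<le> infdist (z (r j)) (accumulation_points z)" by (elim exE conjE)
  then have far: "e \<le> infdist (z (r j)) (accumulation_points z)" for j by blast
  have "(\<lambda>j. infdist (z (r j)) (accumulation_points z)) \<longlonglongrightarrow> infdist w (accumulation_points z)"
    using lim by (intro tendsto_infdist) (simp add: o_def)
  then have "e \<le> infdist w (accumulation_points z)"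
    using far by (intro LIMSEQ_le_const) auto
  with e w show False by simp
qed

lemma frequently_near_zero_of_sign_changes:
  fixes g :: "nat \<Rightarrow> real"
  assumes step: "(\<lambda>k. g (Suc k) - g k) \<longlonglongrightarrow> 0"
    and neg: "\<exists>\<^sub>F k in sequentially. g k < 0" and pos: "\<exists>\<^sub>F k in sequentially. 0 < g k"
    and e: "0 < e"
  shows "\<exists>\<^sub>F k in sequentially. \<bar>g k\<bar> < e"
  unfolding frequently_sequentially
proof
  fix N
  obtain N' where N': "\<And>k. N' \<le> k \<Longrightarrow> \<bar>g (Suc k) - g k\<bar> < e"
    using tendstoD[OF step e] by (auto simp: eventually_sequentially)
  obtain a where a: "max N N' \<le> a" "g a < 0"
    using neg unfolding frequently_sequentially by blast
  obtain b where b: "a \<le> b" "0 < g b"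
    using pos unfolding frequently_sequentially by blast
  \<comment> \<open>The last step before \<open>g\<close> becomes positive crosses zero and is shorter than \<open>e\<close>.\<close>
  define k where "k = (LEAST k. a \<le> k \<and> 0 < g k)"
  have k: "a \<le> k" "0 < g k"
    using LeastI[of "\<lambda>k. a \<le> k \<and> 0 < g k" b] b unfolding k_def by auto
  have "k \<noteq> a" using k a by auto
  then obtain l where l: "k = Suc l" "a \<le> l"
    using k by (cases k) auto
  have "\<not> 0 < g l"
    using not_less_Least[of l "\<lambda>k. a \<le> k \<and> 0 < g k"] l unfolding k_def[symmetric] by auto
  then have "\<bar>g k\<bar> < e" using N'[of l] l a k by auto
  moreover have "N \<le> k" using k a by simp
  ultimately show "\<exists>k\<ge>N. \<bar>g k\<bar> < e" by blast
qed

text \<open>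
  Ostrowski's theorem. If the accumulation points split into disjoint closed parts \<open>A\<close> and \<open>B\<close>, the
  function \<open>g\<close> (distance to \<open>A\<close> minus distance to \<open>B\<close>) is negative infinitely often and positive
  infinitely often along the sequence. As its increments vanish, it comes arbitrarily close to \<open>0\<close>
  infinitely often, which produces an accumulation point at equal distance from \<open>A\<close> and \<open>B\<close>. Such a
  point lies in one of the parts, hence in both.
\<close>

lemma connected_accumulation_points:
  fixes z :: "nat \<Rightarrow> 'a::{heine_borel,real_normed_vector}"
  assumes z: "bounded (range z)" and step: "(\<lambda>k. z (Suc k) - z k) \<longlonglongrightarrow> 0"
  shows "connected (accumulation_points z)"
proof (rule ccontr)
  let ?W = "accumulation_points z"
  assume "\<not> connected ?W"
  then obtain A B where AB: "closed A" "closed B" "A \<noteq> {}" "B \<noteq> {}" "A \<union> B = ?W" "A \<inter> B = {}"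
    using connected_closed_set[OF compact_imp_closed[OF compact_accumulation_points[OF z]]] by blast
  define g where "g x = infdist x A - infdist x B" for x
  have zero_A: "infdist x A = 0 \<longleftrightarrow> x \<in> A" and zero_B: "infdist x B = 0 \<longleftrightarrow> x \<in> B" for x
    using AB by (simp_all add: in_closed_iff_infdist_zero)
  have g_cont: "isCont g x" for x
    unfolding g_def by (intro continuous_intros)
  have near: "\<exists>\<^sub>F k in sequentially. z k \<in> U" if "x \<in> ?W" "open U" "x \<in> U" for x U
  proof -
    obtain e where e: "0 < e" "ball x e \<subseteq> U" using \<open>open U\<close> \<open>x \<in> U\<close> open_contains_ball by blast
    have "\<exists>\<^sub>F k in sequentially. dist (z k) x < e"
      using that(1)[unfolded accumulation_points_frequently[OF z]] e(1) by blast
    then show ?thesis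
      by (rule frequently_elim1) (use e in \<open>auto simp: dist_commute mem_ball subset_iff\<close>)
  qed
  have cont: "continuous_on UNIV g" using g_cont by (simp add: continuous_at_imp_continuous_on)
  have op: "open {x. g x < 0}" "open {x. 0 < g x}"
    using cont by (auto intro!: open_Collect_less continuous_intros)
  obtain a b where ab: "a \<in> A" "b \<in> B" using AB by blast
  have "a \<notin> B" "b \<notin> A" using ab AB by auto
  then have "infdist a B \<noteq> 0" "infdist b A \<noteq> 0" by (simp_all add: zero_A zero_B)
  then have "g a < 0" "0 < g b"
    using ab infdist_nonneg[of a B] infdist_nonneg[of b A] by (auto simp: g_def)
  then have signs: "\<exists>\<^sub>F k in sequentially. g (z k) < 0" "\<exists>\<^sub>F k in sequentially. 0 < g (z k)"
    using near[OF _ op(1), of a] near[OF _ op(2), of b] ab AB by auto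
  have le: "\<bar>g (z (Suc k)) - g (z k)\<bar> \<le> 2 * norm (z (Suc k) - z k)" for k
    using infdist_triangle_abs[of "z (Suc k)" A "z k"] infdist_triangle_abs[of "z (Suc k)" B "z k"]
    unfolding g_def dist_norm by linarith
  have "(\<lambda>k. 2 * norm (z (Suc k) - z k)) \<longlonglongrightarrow> 0"
    by (rule tendsto_mult_right_zero[OF tendsto_norm_zero[OF step]])
  then have g_step: "(\<lambda>k. g (z (Suc k)) - g (z k)) \<longlonglongrightarrow> 0"
    by (rule Lim_null_comparison[rotated]) (simp add: le)
  have "\<exists>\<^sub>F k in sequentially. \<bar>g (z k)\<bar> < 1 / real (Suc j)" for j
    by (rule frequently_near_zero_of_sign_changes[OF g_step signs]) simp
  from frequently_subseq_limit[where P = "\<lambda>j k. \<bar>g (z k)\<bar> < 1 / real (Suc j)", OF z this]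
  obtain r w where lim: "(z \<circ> r) \<longlonglongrightarrow> w" and w: "w \<in> ?W"
    and small: "\<forall>j. \<exists>i\<ge>j. \<bar>g (z (r j))\<bar> < 1 / real (Suc i)" by (elim exE conjE)
  have g_le: "\<bar>g (z (r j))\<bar> \<le> inverse (real (Suc j))" for j
  proof -
    obtain i where "j \<le> i" "\<bar>g (z (r j))\<bar> < 1 / real (Suc i)" using small by blast
    moreover have "1 / real (Suc i) \<le> inverse (real (Suc j))"
      using \<open>j \<le> i\<close> by (simp add: frac_le inverse_eq_divide)
    ultimately show ?thesis by simp
  qed
  have "(\<lambda>j. g (z (r j))) \<longlonglongrightarrow> 0"
    by (rule Lim_null_comparison[OF _ LIMSEQ_inverse_real_of_nat])
      (simp only: real_norm_def g_le eventually_True)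
  moreover have "(\<lambda>j. g (z (r j))) \<longlonglongrightarrow> g w"
    using isCont_tendsto_compose[OF g_cont lim] by (simp add: o_def)
  ultimately have "g w = 0" using LIMSEQ_unique by blast
  then have "infdist w A = infdist w B" by (simp add: g_def)
  moreover have "infdist w A = 0 \<or> infdist w B = 0"
    using w AB(5) zero_A zero_B by blast
  ultimately have "infdist w A = 0" "infdist w B = 0" by auto
  then have "w \<in> A \<and> w \<in> B" by (simp only: zero_A zero_B)
  with AB(6) show False by blast
qed

section \<open>Sequences that decrease up to summable errors\<close>

text \<open>
  Subtracting the accumulated errors \<open>c\<close> from \<open>a\<close> gives a sequence that really decreases.
\<close>

lemma almost_decreasing_converges:
  fixes a b c :: "nat \<Rightarrow> real"
  assumes dec: "\<And>k. a (Suc k) \<le> a k - b k + c k" and b: "\<And>k. 0 \<le> b k"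
    and c: "\<And>k. 0 \<le> c k" "summable c" and lower: "\<And>k. l \<le> a k"
  shows "convergent a" "summable b"
proof -
  define s where "s k = a k - (\<Sum>j<k. c j)" for k
  have s_step: "s (Suc k) \<le> s k - b k" for k
    using dec[of k] by (simp add: s_def)
  have "decseq s"
    using s_step b by (intro decseq_SucI) (meson diff_le_eq le_add_same_cancel1 order_trans)
  have sum_c: "(\<Sum>j<k. c j) \<le> suminf c" for k
    using c by (intro sum_le_suminf) auto
  have s_low: "l - suminf c \<le> s k" for k
    using lower[of k] sum_c[of k] by (simp add: s_def)
  obtain L where "s \<longlonglongrightarrow> L"
    using decseq_convergent[OF \<open>decseq s\<close>] s_low by blast
  then have "(\<lambda>k. s k + (\<Sum>j<k. c j)) \<longlonglongrightarrow> L + suminf c"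
    by (intro tendsto_add summable_LIMSEQ c)
  then show "convergent a" by (auto simp: s_def convergent_def)
  \<comment> \<open>Telescoping: the decrease of \<open>s\<close> up to \<open>k\<close> pays for the first \<open>k\<close> terms of \<open>b\<close>.\<close>
  have tele: "(\<Sum>j<k. b j) \<le> s 0 - s k" for k
  proof (induction k)
    case (Suc k) then show ?case using s_step[of k] by simp
  qed simp
  show "summable b"
  proof (rule summableI_nonneg_bounded[OF b])
    show "(\<Sum>j<k. b j) \<le> s 0 - (l - suminf c)" for k
      using tele[of k] s_low[of k] by linarith
  qed
qed

section \<open>Closed convex sets and convex inequality systems\<close>

lemma convex_infdist_sublevel:
  fixes S :: "'a::euclidean_space set"
  assumes S: "convex S" "closed S" "S \<noteq> {}"
  shows "convex {w. infdist w S \<le> r}"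
proof (rule convexI)
  fix x y and u v :: real
  assume xy: "x \<in> {w. infdist w S \<le> r}" "y \<in> {w. infdist w S \<le> r}"
    and uv: "0 \<le> u" "0 \<le> v" "u + v = 1"
  obtain a where a: "a \<in> S" "infdist x S = dist x a"
    using infdist_attains_inf[OF S(2,3)] by metis
  obtain b where b: "b \<in> S" "infdist y S = dist y b"
    using infdist_attains_inf[OF S(2,3)] by metis
  have "u *\<^sub>R a + v *\<^sub>R b \<in> S" using convexD[OF S(1) a(1) b(1) uv] .
  then have "infdist (u *\<^sub>R x + v *\<^sub>R y) S \<le> dist (u *\<^sub>R x + v *\<^sub>R y) (u *\<^sub>R a + v *\<^sub>R b)"
    by (rule infdist_le)
  also have "\<dots> = norm (u *\<^sub>R (x - a) + v *\<^sub>R (y - b))"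
    by (simp add: dist_norm algebra_simps)
  also have "\<dots> \<le> u * dist x a + v * dist y b"
    using norm_triangle_ineq[of "u *\<^sub>R (x - a)" "v *\<^sub>R (y - b)"] uv by (simp add: dist_norm)
  also have "\<dots> \<le> u * r + v * r"
    using xy a(2) b(2) uv by (intro add_mono mult_left_mono) auto
  also have "\<dots> = r" using uv(3) by (simp add: distrib_right[symmetric])
  finally show "u *\<^sub>R x + v *\<^sub>R y \<in> {w. infdist w S \<le> r}" by simp
qed

lemma compact_infdist_sublevel:
  fixes S :: "'a::euclidean_space set"
  assumes V: "closed V" and S: "compact S" "S \<noteq> {}"
  shows "compact {w \<in> V. infdist w S \<le> r}"
  unfolding compact_eq_bounded_closed
proof
  obtain b where b: "\<And>x. x \<in> S \<Longrightarrow> norm x \<le> b"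
    using compact_imp_bounded[OF S(1)] unfolding bounded_iff by blast
  have "norm w \<le> b + r" if "w \<in> {w \<in> V. infdist w S \<le> r}" for w
  proof -
    obtain a where a: "a \<in> S" "infdist w S = dist w a"
      using infdist_attains_inf[OF compact_imp_closed[OF S(1)] S(2)] by metis
    have "norm w \<le> norm a + dist w a"
      using norm_triangle_ineq[of a "w - a"] by (simp add: dist_norm)
    also have "\<dots> \<le> b + r" using that a b by (intro add_mono) auto
    finally show ?thesis .
  qed
  then show "bounded {w \<in> V. infdist w S \<le> r}" unfolding bounded_iff by blast
  have "closed (V \<inter> {w. infdist w S \<le> r})"
    by (intro closed_Int V closed_Collect_le continuous_intros)
  then show "closed {w \<in> V. infdist w S \<le> r}" by (simp add: Collect_conj_eq)
qed

text \<open>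
  A compact solution set of a convex system moves little when the right-hand side \<open>0\<close> is replaced by a
  small \<open>\<mu>\<close>. On the compact set of points at distance exactly \<open>\<delta>\<close> from \<open>S\<close> the total violation has a
  positive minimum; a point farther away with violation at most \<open>\<mu>\<close> would, by convexity along the
  segment to its projection, produce a point at distance \<open>\<delta>\<close> where the violation is below that
  minimum. This is how the iterates, which may start anywhere, are seen to enter the region where the
  gradient is Lipschitz.
\<close>

lemma infdist_le_of_small_violation:
  fixes g :: "'c \<Rightarrow> 'a::euclidean_space \<Rightarrow> real"
  assumes V: "subspace V" and I: "finite I"
    and conv: "\<And>c. c \<in> I \<Longrightarrow> convex_on V (g c)"
    and cont: "\<And>c. c \<in> I \<Longrightarrow> continuous_on V (g c)"
    and S: "S = {w \<in> V. \<forall>c\<in>I. g c w \<le> 0}" "compact S" "S \<noteq> {}" and \<delta>: "0 < \<delta>"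
  shows "\<exists>\<mu>>0. \<forall>w\<in>V. (\<forall>c\<in>I. g c w \<le> \<mu>) \<longrightarrow> infdist w S \<le> \<delta>"
proof -
  define T where "T = {w \<in> V. infdist w S = \<delta>}"
  define \<phi> where "\<phi> w = (\<Sum>c\<in>I. max (g c w) 0)" for w
  have T_eq: "T = {w \<in> V. infdist w S \<le> \<delta>} \<inter> {w. \<delta> \<le> infdist w S}"
    by (auto simp: T_def)
  have "compact T"
    unfolding T_eq
    by (intro compact_Int_closed compact_infdist_sublevel closed_subspace V S
        closed_Collect_le continuous_intros)
  have \<phi>_cont: "continuous_on T \<phi>"
    unfolding \<phi>_def
    by (intro continuous_intros continuous_on_subset[OF cont]) (auto simp: T_def)
  have \<phi>_pos: "0 < \<phi> w" if "w \<in> T" for w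
  proof -
    have w: "w \<in> V" "infdist w S = \<delta>" using that unfolding T_def by blast+
    have "w \<notin> S" using w(2) \<delta> by auto
    then obtain c where "c \<in> I" "0 < g c w"
      using w(1) unfolding S(1) mem_Collect_eq by (metis not_le)
    then show ?thesis unfolding \<phi>_def by (intro sum_pos2[OF I, of c]) auto
  qed
  have "\<exists>m>0. \<forall>w\<in>T. m \<le> \<phi> w"
  proof (cases "T = {}")
    case True then show ?thesis by (intro exI[of _ 1]) auto
  next
    case False
    then show ?thesis using continuous_attains_inf[OF \<open>compact T\<close> False \<phi>_cont] \<phi>_pos by blast
  qed
  then obtain m where m: "0 < m" "\<And>w. w \<in> T \<Longrightarrow> m \<le> \<phi> w" by blast
  define \<mu> where "\<mu> = m / (real (card I) + 1)"
  have \<mu>: "0 < \<mu>" unfolding \<mu>_def using m(1) by simp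
  have \<mu>_m: "real (card I) * \<mu> < m" unfolding \<mu>_def using m(1) by (simp add: field_simps)
  have "infdist w S \<le> \<delta>" if w: "w \<in> V" "\<And>c. c \<in> I \<Longrightarrow> g c w \<le> \<mu>" for w
  proof (rule ccontr)
    define d where "d = infdist w S"
    assume "\<not> infdist w S \<le> \<delta>"
    then have d: "\<delta> < d" by (simp add: d_def)
    obtain y where y: "y \<in> S" "d = dist w y"
      using infdist_attains_inf[OF compact_imp_closed[OF S(2)] S(3)] unfolding d_def by metis
    define s where "s = \<delta> / d"
    have s: "0 < s" "s < 1" "s * d = \<delta>" using d \<delta> by (auto simp: s_def)
    \<comment> \<open>The point at distance \<open>\<delta>\<close> on the segment from the projection \<open>y\<close> to \<open>w\<close>.\<close>
    define u where "u = (1 - s) *\<^sub>R y + s *\<^sub>R w"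
    have yV: "y \<in> V" using y by (simp add: S(1))
    have uV: "u \<in> V" unfolding u_def using V yV w(1) by (intro subspace_add subspace_scale)
    have "u - y = s *\<^sub>R (w - y)" "w - u = (1 - s) *\<^sub>R (w - y)"
      by (simp_all add: u_def algebra_simps)
    then have du: "dist u y = s * d" "dist w u = (1 - s) * d"
      using s by (simp_all add: dist_norm y(2))
    have "infdist u S \<le> \<delta>" using infdist_le[OF y(1), of u] du s by simp
    moreover have "\<delta> \<le> infdist u S"
      using infdist_triangle[of w S u] du s by (simp add: d_def[symmetric] algebra_simps)
    ultimately have "u \<in> T" using uV by (simp add: T_def)
    have "max (g c u) 0 \<le> \<mu>" if c: "c \<in> I" for c
    proof -
      have "g c u \<le> (1 - s) * g c y + s * g c w"
        unfolding u_def using convex_onD[OF conv[OF c], of s y w] s yV w by simp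
      also have "\<dots> \<le> (1 - s) * 0 + 1 * \<mu>"
        using s y c w(2)[OF c] \<mu> unfolding S(1)
        by (intro add_mono mult_left_mono order_trans[OF mult_left_mono[of "g c w" \<mu> s] mult_right_mono])
          auto
      finally show ?thesis using \<mu> by simp
    qed
    then have "\<phi> u \<le> (\<Sum>c\<in>I. \<mu>)" unfolding \<phi>_def by (rule sum_mono)
    with m(2)[OF \<open>u \<in> T\<close>] \<mu>_m show False by simp
  qed
  with \<mu> show ?thesis by blast
qed

section \<open>Consequences of a small residual\<close>

lemma residual_leD:
  fixes blk :: "'d::finite \<Rightarrow> nat"
  assumes p: "0 < p i" and r: "residual blk p h i x lam xt \<le> e"
  defines "v \<equiv> x - xt + (\<Sum>c\<in>{1..p i}. lam c *\<^sub>R grad_on (block_space blk i) (h i c) x)"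
  shows "x \<bullet> v \<le> e" "infnorm v \<le> e" "\<And>c. c \<in> {1..p i} \<Longrightarrow> h i c x \<le> e"
    "- (\<Sum>c\<in>{1..p i}. lam c * h i c x) \<le> e"
proof -
  let ?H = "(\<lambda>c. \<bar>max (h i c x) 0\<bar>) ` {1..p i}"
  have H: "h i c x \<le> Max ?H" if "c \<in> {1..p i}" for c
  proof -
    have "\<bar>max (h i c x) 0\<bar> \<le> Max ?H" using that by (intro Max_ge) auto
    then show ?thesis by linarith
  qed
  have "\<bar>max (h i 1 x) 0\<bar> \<le> Max ?H" using p by (intro Max_ge) auto
  then have H0: "0 \<le> Max ?H" by linarith
  have sum: "max (x \<bullet> v) 0 + infnorm v + Max ?H + max (- (\<Sum>c\<in>{1..p i}. lam c * h i c x)) 0 \<le> e"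
    using r unfolding residual_def Let_def v_def .
  have "0 \<le> infnorm v" by (rule infnorm_pos_le)
  then show "x \<bullet> v \<le> e" "infnorm v \<le> e" "- (\<Sum>c\<in>{1..p i}. lam c * h i c x) \<le> e"
    using sum H0 by linarith+
  show "h i c x \<le> e" if "c \<in> {1..p i}" for c
    using H[OF that] sum \<open>0 \<le> infnorm v\<close> by linarith
qed

text \<open>
  For an exact multiplier pair the right-hand side would be \<open>0\<close>: this is the inequality that
  characterises the projection of \<open>xt\<close> on the feasible set. Its form is chosen so that the error is
  linear in the residual, i.e. of order \<open>eps\<^sup>2\<close>, whereas the distance to the projection is only of
  order \<open>eps\<close>, which is not summable in general. Convexity bounds \<open>lam c * (G \<bullet> (y - x))\<close> by
  \<open>lam c * (h y - h x)\<close>, so that the multipliers enter only through the complementarity term of the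
  residual, however large they are.
\<close>

lemma residual_variational_inequality:
  fixes blk :: "'d::finite \<Rightarrow> nat"
  assumes p: "0 < p i" and r: "residual blk p h i x lam xt \<le> e"
    and lam: "\<forall>c\<in>{1..p i}. 0 \<le> lam c"
    and conv: "\<forall>c\<in>{1..p i}. convex_on (block_space blk i) (h i c)"
    and diff: "\<forall>c\<in>{1..p i}. h i c differentiable_on block_space blk i"
    and x: "x \<in> block_space blk i"
    and y: "y \<in> feasible blk p h i" and R: "norm y \<le> R"
  shows "(xt - x) \<bullet> (y - x) \<le> (2 + sqrt (real CARD('d)) * R) * e"
proof -
  let ?V = "block_space blk i" and ?s = "sqrt (real CARD('d))"
  let ?G = "\<lambda>c. grad_on ?V (h i c) x"
  define v where "v = x - xt + (\<Sum>c\<in>{1..p i}. lam c *\<^sub>R ?G c)"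
  have v: "x \<bullet> v \<le> e" "infnorm v \<le> e" "- (\<Sum>c\<in>{1..p i}. lam c * h i c x) \<le> e"
    using residual_leD[OF p r] unfolding v_def by blast+
  have "norm v \<le> ?s * infnorm v" using norm_le_infnorm[of v] by simp
  also have "\<dots> \<le> ?s * e" using v(2) by (intro mult_left_mono) auto
  finally have nv: "norm v \<le> ?s * e" .
  have e: "0 \<le> e" using v(2) infnorm_pos_le[of v] by linarith
  have "- (v \<bullet> y) \<le> norm v * norm y" using Cauchy_Schwarz_ineq2[of v y] by linarith
  also have "\<dots> \<le> (?s * e) * R" using nv R e by (intro mult_mono) auto
  finally have vy: "- (v \<bullet> y) \<le> ?s * R * e" by (simp add: mult_ac)
  have yV: "y \<in> ?V" and hy: "\<And>c. c \<in> {1..p i} \<Longrightarrow> h i c y \<le> 0"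
    using y by (auto simp: feasible_def)
  have "lam c * (?G c \<bullet> (y - x)) \<le> - (lam c * h i c x)" if c: "c \<in> {1..p i}" for c
  proof -
    have "?G c \<bullet> (y - x) \<le> h i c y - h i c x"
      using c conv diff x yV by (intro convex_on_subspace_gradient_inequality subspace_block_space) auto
    also have "\<dots> \<le> - h i c x" using hy[OF c] by simp
    finally show ?thesis using lam c mult_left_mono[of _ "- h i c x" "lam c"] by fastforce
  qed
  then have "(\<Sum>c\<in>{1..p i}. lam c * (?G c \<bullet> (y - x))) \<le> (\<Sum>c\<in>{1..p i}. - (lam c * h i c x))"
    by (rule sum_mono)
  then have G: "(\<Sum>c\<in>{1..p i}. lam c * (?G c \<bullet> (y - x))) \<le> e"
    using v(3) by (simp add: sum_negf)
  have "xt - x = (\<Sum>c\<in>{1..p i}. lam c *\<^sub>R ?G c) - v" by (simp add: v_def)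
  then have "(xt - x) \<bullet> (y - x)
      = (\<Sum>c\<in>{1..p i}. lam c * (?G c \<bullet> (y - x))) - v \<bullet> y + x \<bullet> v"
    by (simp only: inner_diff_left inner_sum_left inner_scaleR_left)
      (simp add: inner_diff_right inner_commute)
  also have "\<dots> \<le> e + ?s * R * e + e" using G vy v(1) by linarith
  finally show ?thesis by (simp add: algebra_simps)
qed

section \<open>Descent along one block\<close>

text \<open>
  The Lipschitz condition is required only along the segment and only in its direction, because the
  gradient is known to be Lipschitz blockwise and on a convex set only.
\<close>

lemma descent_along_segment:
  fixes f :: "'a::euclidean_space \<Rightarrow> real"
  assumes f: "\<And>x. (f has_derivative (\<lambda>v. G x \<bullet> v)) (at x)"
    and lip: "\<And>t. 0 \<le> t \<Longrightarrow> t \<le> 1 \<Longrightarrow> (G (u + t *\<^sub>R d) - G u) \<bullet> d \<le> l * t * (norm d)\<^sup>2"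
  shows "f (u + d) \<le> f u + G u \<bullet> d + l / 2 * (norm d)\<^sup>2"
proof -
  define \<phi> where "\<phi> t = f (u + t *\<^sub>R d) - t * (G u \<bullet> d) - l / 2 * t\<^sup>2 * (norm d)\<^sup>2" for t :: real
  have der: "(\<phi> has_real_derivative (G (u + t *\<^sub>R d) \<bullet> d - G u \<bullet> d - l * t * (norm d)\<^sup>2)) (at t)" for t
  proof -
    have 1: "((\<lambda>t::real. u + t *\<^sub>R d) has_derivative (\<lambda>t. t *\<^sub>R d)) (at t)"
      by (auto intro!: derivative_eq_intros)
    have "((\<lambda>t. f (u + t *\<^sub>R d)) has_derivative (\<lambda>s. G (u + t *\<^sub>R d) \<bullet> (s *\<^sub>R d))) (at t)"
      using has_derivative_compose[OF 1 f] .
    then have "((\<lambda>t. f (u + t *\<^sub>R d)) has_real_derivative G (u + t *\<^sub>R d) \<bullet> d) (at t)"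
      by (simp add: has_field_derivative_def mult.commute[of _ "G (u + t *\<^sub>R d) \<bullet> d"])
    then show ?thesis
      unfolding \<phi>_def by (auto intro!: derivative_eq_intros)
  qed
  have neg: "G (u + t *\<^sub>R d) \<bullet> d - G u \<bullet> d - l * t * (norm d)\<^sup>2 \<le> 0" if "0 \<le> t" "t \<le> 1" for t
    using lip[OF that] by (simp add: inner_diff_left)
  have "\<phi> 1 \<le> \<phi> 0"
  proof (rule DERIV_nonpos_imp_nonincreasing[of 0 1 \<phi>])
    show "\<exists>y. (\<phi> has_real_derivative y) (at t) \<and> y \<le> 0" if "0 \<le> t" "t \<le> 1" for t
      using der[of t] neg[OF that] by blast
  qed simp
  then show ?thesis by (simp add: \<phi>_def)
qed

section \<open>Inexact block proximal gradient steps\<close>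

lemma bounded_image_of_lipschitz:
  fixes g :: "'a::real_normed_vector \<Rightarrow> 'b::real_normed_vector"
  assumes A: "bounded A" and lip: "\<And>x y. x \<in> A \<Longrightarrow> y \<in> A \<Longrightarrow> norm (g x - g y) \<le> l * norm (x - y)"
  shows "bounded (g ` A)"
proof (cases "A = {}")
  case False
  then obtain a where a: "a \<in> A" by blast
  obtain b where b: "\<And>x. x \<in> A \<Longrightarrow> norm x \<le> b" using A unfolding bounded_iff by blast
  have "norm (g x) \<le> norm (g a) + \<bar>l\<bar> * (b + b)" if x: "x \<in> A" for x
  proof -
    have "norm (x - a) \<le> b + b"
      using norm_triangle_ineq4[of x a] b[OF x] b[OF a] by linarith
    then have "l * norm (x - a) \<le> \<bar>l\<bar> * (b + b)" by (intro mult_mono) auto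
    moreover have "norm (g x) \<le> norm (g a) + norm (g x - g a)"
      using norm_triangle_ineq[of "g a" "g x - g a"] by simp
    ultimately show ?thesis using lip[OF x a] by linarith
  qed
  then show ?thesis unfolding bounded_iff by blast
qed simp

text \<open>
  The part of the algorithm that matters for convergence, with residuals and multipliers replaced by
  their consequences: each new block is within \<open>e\<close> of the feasible set \<open>S i\<close> and satisfies the
  projection inequality up to \<open>e\<close>, for one summable sequence \<open>e\<close>. The sets \<open>C i\<close> are the larger
  compact sets on whose product the gradient is Lipschitz. The error indices are shifted so that \<open>e k\<close>
  belongs to the step that produced \<open>z k\<close>.
\<close>

locale inexact_block_prox =
  fixes blk :: "'d::finite \<Rightarrow> nat" and n :: nat and f :: "real ^ 'd \<Rightarrow> real"
    and S C :: "nat \<Rightarrow> (real ^ 'd) set" and L :: "nat \<Rightarrow> real" and Ml M :: real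
    and sig :: "nat \<Rightarrow> nat \<Rightarrow> real" and z :: "nat \<Rightarrow> real ^ 'd" and e :: "nat \<Rightarrow> real"
  assumes blk_range: "\<forall>j. blk j \<in> {1..n}"
    and f_diff: "f differentiable_on UNIV"
    and S_closed: "i \<in> {1..n} \<Longrightarrow> closed (S i)" and S_nonempty: "i \<in> {1..n} \<Longrightarrow> S i \<noteq> {}"
    and S_subset: "i \<in> {1..n} \<Longrightarrow> S i \<subseteq> C i"
    and C_convex: "i \<in> {1..n} \<Longrightarrow> convex (C i)" and C_compact: "i \<in> {1..n} \<Longrightarrow> compact (C i)"
    and lipschitz: "i \<in> {1..n} \<Longrightarrow> z1 \<in> block_prod blk n C \<Longrightarrow> z2 \<in> block_prod blk n C \<Longrightarrow>
      norm (block_grad blk i f z1 - block_grad blk i f z2) \<le> L i * norm (z1 - z2)"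
    and Ml_pos: "0 < Ml" and L_le: "i \<in> {1..n} \<Longrightarrow> L i \<le> Ml"
    and sig: "i \<in> {1..n} \<Longrightarrow> Ml \<le> sig k i" "i \<in> {1..n} \<Longrightarrow> sig k i \<le> M"
    and z_in: "z k \<in> block_prod blk n C"
    and e_nonneg: "0 \<le> e k" and e_summable: "summable e"
    and near: "i \<in> {1..n} \<Longrightarrow> infdist (block blk i (z k)) (S i) \<le> e k"
    and variational: "i \<in> {1..n} \<Longrightarrow> y \<in> S i \<Longrightarrow>
      (block blk i (z k) - (1 / sig k i) *\<^sub>R partial_grad blk f z k i - block blk i (z (Suc k)))
        \<bullet> (y - block blk i (z (Suc k))) \<le> e (Suc k)"
begin

abbreviation (input) P :: "(real ^ 'd) set" where "P \<equiv> block_prod blk n C"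

lemma compact_P: "compact P"
  using blk_range C_compact by (rule compact_block_prod)

lemma mixed_in_P: "mixed blk i (z (Suc k)) (z k) \<in> P"
  using z_in z_in by (rule mixed_in_block_prod)

lemma P_diameter: "\<exists>D\<ge>0. \<forall>x\<in>P. \<forall>y\<in>P. norm (x - y) \<le> D"
proof -
  obtain b where b: "\<And>x. x \<in> P \<Longrightarrow> norm x \<le> b"
    using compact_imp_bounded[OF compact_P] unfolding bounded_iff by blast
  have "norm (x - y) \<le> b + b" if "x \<in> P" "y \<in> P" for x y
    using norm_triangle_ineq4[of x y] b[OF that(1)] b[OF that(2)] by linarith
  moreover have "0 \<le> b + b" using b[OF z_in[of 0]] norm_ge_zero[of "z 0"] by linarith
  ultimately show ?thesis by blast
qed

lemma block_grad_bounded: "\<exists>B\<ge>0. \<forall>i\<in>{1..n}. \<forall>x\<in>P. norm (block_grad blk i f x) \<le> B"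
proof -
  have "bounded (\<Union>i\<in>{1..n}. block_grad blk i f ` P)"
    using lipschitz
    by (intro bounded_UN ballI finite_atLeastAtMost
        bounded_image_of_lipschitz[OF compact_imp_bounded[OF compact_P]])
  then obtain b where b: "\<forall>v\<in>(\<Union>i\<in>{1..n}. block_grad blk i f ` P). norm v \<le> b"
    unfolding bounded_iff by blast
  have "\<forall>i\<in>{1..n}. \<forall>x\<in>P. norm (block_grad blk i f x) \<le> max b 0"
  proof (intro ballI)
    fix i x assume "i \<in> {1..n}" "x \<in> P"
    then have "norm (block_grad blk i f x) \<le> b" using b by blast
    then show "norm (block_grad blk i f x) \<le> max b 0" by simp
  qed
  then show ?thesis by (intro exI[of _ "max b 0"]) simp
qed

lemma nearby_feasible_block:
  assumes i: "i \<in> {1..n}"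
  obtains y where "y \<in> S i" "norm (block blk i (z k) - y) \<le> e k"
  using infdist_attains_inf[OF S_closed[OF i] S_nonempty[OF i], of "block blk i (z k)"] near[OF i, of k]
  by (metis dist_norm)

text \<open>
  The approximate projection inequality can be tested only against feasible points, and the previous
  block need not be feasible. Testing with a feasible \<open>y\<close> near the previous block and moving from \<open>y\<close>
  to that block costs terms proportional to \<open>e k\<close>.
\<close>

lemma partial_grad_inner_step:
  fixes k :: nat
  assumes i: "i \<in> {1..n}"
    and D: "\<forall>x\<in>P. \<forall>y\<in>P. norm (x - y) \<le> D"
    and B: "\<forall>i\<in>{1..n}. \<forall>x\<in>P. norm (block_grad blk i f x) \<le> B"
  defines "d \<equiv> block blk i (z (Suc k)) - block blk i (z k)"
  shows "partial_grad blk f z k i \<bullet> d \<le> - (sig k i * (norm d)\<^sup>2) + M * e (Suc k) + (M * D + B) * e k"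
proof -
  let ?g = "partial_grad blk f z k i" and ?\<sigma> = "sig k i"
  let ?x = "block blk i (z k)" and ?x' = "block blk i (z (Suc k))"
  have \<sigma>: "0 < ?\<sigma>" "?\<sigma> \<le> M" using sig[OF i, of k] Ml_pos by auto
  obtain y where y: "y \<in> S i" "norm (?x - y) \<le> e k" using nearby_feasible_block[OF i] by blast
  have "norm d \<le> norm (z (Suc k) - z k)"
    unfolding d_def block_diff[symmetric] by (rule norm_block_le)
  also have "\<dots> \<le> D" using D z_in by blast
  finally have dD: "norm d \<le> D" .
  have gB: "norm ?g \<le> B" unfolding partial_grad_def using B i mixed_in_P by blast
  have "?\<sigma> * ((?x - (1 / ?\<sigma>) *\<^sub>R ?g - ?x') \<bullet> (y - ?x')) \<le> ?\<sigma> * e (Suc k)"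
    using variational[OF i y(1), of k] \<sigma> by (intro mult_left_mono) auto
  also have "?\<sigma> * ((?x - (1 / ?\<sigma>) *\<^sub>R ?g - ?x') \<bullet> (y - ?x'))
      = ?\<sigma> * ((?x - ?x') \<bullet> (y - ?x')) - ?g \<bullet> (y - ?x')"
    using \<sigma> by (simp add: inner_diff_left right_diff_distrib)
  finally have vi: "?\<sigma> * ((?x - ?x') \<bullet> (y - ?x')) - ?g \<bullet> (y - ?x') \<le> ?\<sigma> * e (Suc k)" .
  have split1: "(?x - ?x') \<bullet> (y - ?x') = (norm d)\<^sup>2 - d \<bullet> (y - ?x)"
    by (simp add: d_def power2_norm_eq_inner algebra_simps inner_commute)
  have split2: "?g \<bullet> d = - (?g \<bullet> (y - ?x')) + ?g \<bullet> (y - ?x)"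
    by (simp add: d_def algebra_simps)
  have yx: "norm (y - ?x) \<le> e k" using y(2) by (simp add: norm_minus_commute)
  have "d \<bullet> (y - ?x) \<le> norm d * norm (y - ?x)" by (rule norm_cauchy_schwarz)
  also have "\<dots> \<le> D * e k" using dD yx by (intro mult_mono) (auto intro: order_trans[OF norm_ge_zero])
  finally have "?\<sigma> * (d \<bullet> (y - ?x)) \<le> ?\<sigma> * (D * e k)" using \<sigma> by (intro mult_left_mono) auto
  also have "\<dots> \<le> M * (D * e k)"
    using \<sigma> e_nonneg[of k] order_trans[OF norm_ge_zero dD] by (intro mult_right_mono mult_nonneg_nonneg) auto
  finally have 1: "?\<sigma> * (d \<bullet> (y - ?x)) \<le> M * (D * e k)" .
  have "?g \<bullet> (y - ?x) \<le> norm ?g * norm (y - ?x)" by (rule norm_cauchy_schwarz)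
  also have "\<dots> \<le> B * e k" using gB yx by (intro mult_mono) (auto intro: order_trans[OF norm_ge_zero])
  finally have 2: "?g \<bullet> (y - ?x) \<le> B * e k" .
  have 3: "?\<sigma> * e (Suc k) \<le> M * e (Suc k)" using \<sigma> e_nonneg by (intro mult_right_mono) auto
  have "?g \<bullet> d \<le> - (?\<sigma> * (norm d)\<^sup>2) + M * e (Suc k) + M * (D * e k) + B * e k"
    using vi 1 2 3 unfolding split1 split2 right_diff_distrib by linarith
  then show ?thesis by (simp add: algebra_simps)
qed

lemma block_descent:
  fixes k :: nat
  assumes i: "i \<in> {1..n}"
  defines "u \<equiv> mixed blk i (z (Suc k)) (z k)" and "d \<equiv> block blk i (z (Suc k)) - block blk i (z k)"
  shows "f (mixed blk (Suc i) (z (Suc k)) (z k))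
    \<le> f u + partial_grad blk f z k i \<bullet> d + L i / 2 * (norm d)\<^sup>2"
proof -
  let ?G = "grad_on UNIV f"
  have next_eq: "mixed blk (Suc i) (z (Suc k)) (z k) = u + d" by (simp add: u_def d_def mixed_Suc)
  have d_block: "block blk i d = d" by (simp add: d_def block_diff block_block)
  have G_d: "?G x \<bullet> d = block_grad blk i f x \<bullet> d" for x
  proof -
    have "?G x \<bullet> d = ?G x \<bullet> block blk i d" by (simp only: d_block)
    then show ?thesis by (simp only: block_grad_eq_block_grad_on[OF f_diff] inner_block_swap)
  qed
  have uP: "u \<in> P" and udP: "u + d \<in> P"
    unfolding next_eq[symmetric] unfolding u_def by (rule mixed_in_P)+
  have convP: "convex P" using C_convex by (rule convex_block_prod)
  have "f (u + d) \<le> f u + ?G u \<bullet> d + L i / 2 * (norm d)\<^sup>2"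
  proof (rule descent_along_segment)
    show "(f has_derivative (\<lambda>v. ?G x \<bullet> v)) (at x)" for x
      by (rule has_derivative_grad_on_UNIV[OF f_diff])
    \<comment> \<open>The segment from one mixed point to the next stays in the convex set \<open>P\<close>.\<close>
    fix t :: real assume t: "0 \<le> t" "t \<le> 1"
    have "(1 - t) *\<^sub>R u + t *\<^sub>R (u + d) \<in> P"
      using convexD_alt[OF convP uP udP t] .
    then have tP: "u + t *\<^sub>R d \<in> P" by (simp add: algebra_simps)
    have "(?G (u + t *\<^sub>R d) - ?G u) \<bullet> d
        = (block_grad blk i f (u + t *\<^sub>R d) - block_grad blk i f u) \<bullet> d"
      by (simp only: inner_diff_left G_d)
    also have "\<dots> \<le> norm (block_grad blk i f (u + t *\<^sub>R d) - block_grad blk i f u) * norm d"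
      by (rule norm_cauchy_schwarz)
    also have "\<dots> \<le> (L i * norm (t *\<^sub>R d)) * norm d"
      using lipschitz[OF i tP uP] by (intro mult_right_mono) auto
    also have "\<dots> = L i * t * (norm d)\<^sup>2" using t by (simp add: power2_eq_square)
    finally show "(?G (u + t *\<^sub>R d) - ?G u) \<bullet> d \<le> L i * t * (norm d)\<^sup>2" .
  qed
  then show ?thesis by (simp add: next_eq G_d partial_grad_def u_def)
qed

text \<open>
  In block \<open>i\<close> the step contributes \<open>- (sig k i - L i / 2)\<close> times its squared length, and
  \<open>sig k i \<ge> Ml \<ge> L i\<close>, so a multiple \<open>Ml / 2\<close> of it remains. The intermediate points, in which the
  first blocks are already updated, telescope from \<open>z k\<close> to \<open>z (Suc k)\<close>.
\<close>

lemma sufficient_decrease: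
  "\<exists>K\<ge>0. \<forall>k. f (z (Suc k)) \<le> f (z k) - Ml / 2 * (norm (z (Suc k) - z k))\<^sup>2 + K * (e k + e (Suc k))"
proof -
  obtain D where D: "0 \<le> D" "\<forall>x\<in>P. \<forall>y\<in>P. norm (x - y) \<le> D" using P_diameter by blast
  obtain B where B: "0 \<le> B" "\<forall>i\<in>{1..n}. \<forall>x\<in>P. norm (block_grad blk i f x) \<le> B"
    using block_grad_bounded by blast
  have M0: "0 \<le> M" if "i \<in> {1..n}" for i using sig[OF that, of 0] Ml_pos by linarith
  define K where "K = \<bar>M\<bar> + \<bar>M\<bar> * D + B"
  have K0: "0 \<le> K" using D B by (simp add: K_def)
  have "f (z (Suc k)) \<le> f (z k) - Ml / 2 * (norm (z (Suc k) - z k))\<^sup>2 + (real n * K) * (e k + e (Suc k))" for k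
  proof -
    define w where "w i = mixed blk i (z (Suc k)) (z k)" for i
    define q where "q i = (norm (block blk i (z (Suc k) - z k)))\<^sup>2" for i
    have step: "f (w (Suc i)) - f (w i) \<le> K * (e k + e (Suc k)) - Ml / 2 * q i" if i: "i \<in> {1..n}" for i
    proof -
      have "f (w (Suc i)) - f (w i)
          \<le> partial_grad blk f z k i \<bullet> (block blk i (z (Suc k)) - block blk i (z k)) + L i / 2 * q i"
        using block_descent[OF i, of k] unfolding w_def q_def block_diff by linarith
      also have "\<dots> \<le> - (sig k i * q i) + M * e (Suc k) + (M * D + B) * e k + L i / 2 * q i"
        using partial_grad_inner_step[OF i D(2) B(2), of k] unfolding q_def block_diff by linarith
      finally have 1: "f (w (Suc i)) - f (w i)
          \<le> - (sig k i * q i) + M * e (Suc k) + (M * D + B) * e k + L i / 2 * q i" .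
      have "(Ml / 2) * q i \<le> (sig k i - L i / 2) * q i"
        using sig(1)[OF i, of k] L_le[OF i] by (intro mult_right_mono) (auto simp: q_def)
      then have 2: "- (sig k i * q i) + L i / 2 * q i \<le> - (Ml / 2 * q i)"
        by (simp add: algebra_simps)
      have 3: "M * e (Suc k) \<le> K * e (Suc k)" "(M * D + B) * e k \<le> K * e k"
        using e_nonneg M0[OF i] D(1) B(1) by (auto intro!: mult_right_mono simp: K_def)
      show ?thesis using 1 2 3 unfolding distrib_left by linarith
    qed
    have n1: "1 \<le> n" using blk_range by (metis atLeastAtMost_iff order_trans)
    have "f (z (Suc k)) - f (z k) = f (w (Suc n)) - f (w 1)"
      unfolding w_def mixed_first[OF blk_range] mixed_last[OF blk_range] ..
    also have "\<dots> = (\<Sum>i=1..n. f (w (Suc i)) - f (w i))"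
      using sum_Suc_diff[of 1 n "\<lambda>i. f (w i)"] n1 by simp
    also have "\<dots> \<le> (\<Sum>i=1..n. K * (e k + e (Suc k)) - Ml / 2 * q i)"
      using step by (rule sum_mono)
    also have "\<dots> = real n * (K * (e k + e (Suc k))) - Ml / 2 * (\<Sum>i=1..n. q i)"
      by (simp add: sum_subtractf sum_distrib_left)
    also have "(\<Sum>i=1..n. q i) = (norm (z (Suc k) - z k))\<^sup>2"
      unfolding q_def by (rule sum_norm_blocks[OF blk_range])
    finally show ?thesis by (simp add: mult.assoc)
  qed
  moreover have "0 \<le> real n * K" using K0 by simp
  ultimately show ?thesis by blast
qed

lemma f_continuous: "isCont f x"
  using has_derivative_continuous[OF has_derivative_grad_on_UNIV[OF f_diff]] .

lemma values_converge: "convergent (\<lambda>k. f (z k))"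
  and steps_tendsto_0: "(\<lambda>k. z (Suc k) - z k) \<longlonglongrightarrow> 0"
proof -
  obtain K where K: "0 \<le> K" and dec: "\<And>k. f (z (Suc k))
      \<le> f (z k) - Ml / 2 * (norm (z (Suc k) - z k))\<^sup>2 + K * (e k + e (Suc k))"
    using sufficient_decrease by blast
  have "continuous_on P f" using f_continuous by (simp add: continuous_at_imp_continuous_on)
  moreover have "P \<noteq> {}" using z_in[of 0] by (metis empty_iff)
  ultimately have "\<exists>x\<in>P. \<forall>y\<in>P. f x \<le> f y" using continuous_attains_inf[OF compact_P] by (iprover)
  then obtain x where x: "f x \<le> f y" if "y \<in> P" for y by (elim bexE) blast
  have sum_e: "summable (\<lambda>k. K * (e k + e (Suc k)))"
    using e_summable by (intro summable_mult summable_add) (simp_all add: summable_Suc_iff)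
  have e0: "0 \<le> K * (e k + e (Suc k))" for k using K e_nonneg by simp
  have q0: "0 \<le> Ml / 2 * (norm (z (Suc k) - z k))\<^sup>2" for k using Ml_pos by simp
  note conv = almost_decreasing_converges[OF dec q0 e0 sum_e x[OF z_in]]
  show "convergent (\<lambda>k. f (z k))" by (rule conv(1))
  have "(\<lambda>k. Ml / 2 * (norm (z (Suc k) - z k))\<^sup>2) \<longlonglongrightarrow> 0"
    using conv(2) by (rule summable_LIMSEQ_zero)
  then have "(\<lambda>k. (2 / Ml) * (Ml / 2 * (norm (z (Suc k) - z k))\<^sup>2)) \<longlonglongrightarrow> 0"
    by (rule tendsto_mult_right_zero)
  then have "(\<lambda>k. (norm (z (Suc k) - z k))\<^sup>2) \<longlonglongrightarrow> 0" using Ml_pos by simp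
  then show "(\<lambda>k. z (Suc k) - z k) \<longlonglongrightarrow> 0"
    by (simp add: power_tendsto_0_iff tendsto_norm_zero_iff)
qed

lemma bounded_range: "bounded (range z)"
  using compact_imp_bounded[OF compact_P] by (rule bounded_subset) (use z_in in blast)

lemma accumulation_points_in_P: "w \<in> accumulation_points z \<Longrightarrow> w \<in> P"
proof -
  assume "w \<in> accumulation_points z"
  then obtain r :: "nat \<Rightarrow> nat" where "(z \<circ> r) \<longlonglongrightarrow> w" unfolding accumulation_points_subseq by blast
  then show "w \<in> P"
    using compact_imp_closed[OF compact_P] z_in by (auto intro: closed_sequentially[of P "z \<circ> r"])
qed

lemma accumulation_points_feasible:
  assumes w: "w \<in> accumulation_points z"
  shows "w \<in> block_prod blk n S"
  unfolding block_prod_def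
proof (intro CollectI ballI)
  fix i assume i: "i \<in> {1..n}"
  obtain r :: "nat \<Rightarrow> nat" where r: "strict_mono r" and lim: "(z \<circ> r) \<longlonglongrightarrow> w"
    using w unfolding accumulation_points_subseq by blast
  have "(\<lambda>j. infdist (block blk i ((z \<circ> r) j)) (S i)) \<longlonglongrightarrow> infdist (block blk i w) (S i)"
    by (intro tendsto_infdist tendsto_block lim)
  moreover have "(e \<circ> r) \<longlonglongrightarrow> 0"
    using summable_LIMSEQ_zero[OF e_summable] r by (rule LIMSEQ_subseq_LIMSEQ)
  ultimately have "infdist (block blk i w) (S i) \<le> 0"
    by (rule LIMSEQ_le) (use near[OF i] in auto)
  then have "infdist (block blk i w) (S i) = 0" using infdist_nonneg[of "block blk i w" "S i"] by linarith
  then show "block blk i w \<in> S i"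
    by (simp only: in_closed_iff_infdist_zero[OF S_closed[OF i] S_nonempty[OF i]])
qed

lemma accumulation_points_value:
  "\<exists>c. \<forall>w\<in>accumulation_points z. f w = c"
proof -
  obtain c where c: "(\<lambda>k. f (z k)) \<longlonglongrightarrow> c" using values_converge unfolding convergent_def by blast
  have "f w = c" if "w \<in> accumulation_points z" for w
  proof -
    obtain r :: "nat \<Rightarrow> nat" where r: "strict_mono r" and lim: "(z \<circ> r) \<longlonglongrightarrow> w"
      using \<open>w \<in> accumulation_points z\<close> unfolding accumulation_points_subseq by blast
    have "(\<lambda>j. f ((z \<circ> r) j)) \<longlonglongrightarrow> f w" by (rule isCont_tendsto_compose[OF f_continuous lim])
    moreover have "(\<lambda>j. f ((z \<circ> r) j)) \<longlonglongrightarrow> c"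
      using LIMSEQ_subseq_LIMSEQ[OF c r] by (simp add: o_def)
    ultimately show ?thesis by (rule LIMSEQ_unique)
  qed
  then show ?thesis by blast
qed

text \<open>
  The approximate projection inequality passes to the limit: consecutive iterates have the same limit
  along the subsequence, so the proximal term disappears, and the partial gradients at the mixed
  points converge by Lipschitz continuity.
\<close>

lemma accumulation_points_variational:
  assumes w: "w \<in> accumulation_points z" and i: "i \<in> {1..n}" and y: "y \<in> S i"
  shows "0 \<le> block_grad blk i f w \<bullet> (y - block blk i w)"
proof -
  obtain r :: "nat \<Rightarrow> nat" where r: "strict_mono r" and lim: "(z \<circ> r) \<longlonglongrightarrow> w"
    using w unfolding accumulation_points_subseq by blast
  have wP: "w \<in> P" using w by (rule accumulation_points_in_P)
  let ?u = "\<lambda>k. mixed blk i (z (Suc k)) (z k)" and ?g = "\<lambda>k. partial_grad blk f z k i"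
  let ?x = "\<lambda>k. block blk i (z k)"
  have zr: "(\<lambda>j. z (r j)) \<longlonglongrightarrow> w" using lim by (simp add: o_def)
  have step: "(\<lambda>j. z (Suc (r j)) - z (r j)) \<longlonglongrightarrow> 0"
    using LIMSEQ_subseq_LIMSEQ[OF steps_tendsto_0 r] by (simp add: o_def)
  have zSr: "(\<lambda>j. z (Suc (r j))) \<longlonglongrightarrow> w"
    using tendsto_add[OF step zr] by simp
  have "(\<lambda>j. ?u (r j) - z (r j)) \<longlonglongrightarrow> 0"
    by (rule Lim_null_comparison[OF _ tendsto_norm_zero[OF step]]) (simp add: norm_mixed_diff_le)
  from tendsto_add[OF this zr] have u_lim: "(\<lambda>j. ?u (r j)) \<longlonglongrightarrow> w" by simp
  have g_le: "norm (?g k - block_grad blk i f w) \<le> L i * norm (?u k - w)" for k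
    unfolding partial_grad_def by (rule lipschitz[OF i mixed_in_P wP])
  have "(\<lambda>j. L i * norm (?u (r j) - w)) \<longlonglongrightarrow> 0"
    using u_lim by (intro tendsto_mult_right_zero tendsto_norm_zero) (simp only: LIM_zero_iff)
  then have "(\<lambda>j. ?g (r j) - block_grad blk i f w) \<longlonglongrightarrow> 0"
    by (rule Lim_null_comparison[rotated]) (simp add: g_le)
  then have g_lim: "(\<lambda>j. ?g (r j)) \<longlonglongrightarrow> block_grad blk i f w" by (simp only: LIM_zero_iff)
  have x_step: "(\<lambda>j. ?x (r j) - ?x (Suc (r j))) \<longlonglongrightarrow> 0"
    using tendsto_diff[OF tendsto_block[OF zr, of blk i] tendsto_block[OF zSr, of blk i]] by simp
  have y_lim: "(\<lambda>j. y - ?x (Suc (r j))) \<longlonglongrightarrow> y - block blk i w"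
    by (intro tendsto_diff tendsto_const tendsto_block zSr)
  have e_lim: "(\<lambda>j. e (Suc (r j))) \<longlonglongrightarrow> 0"
    using LIMSEQ_subseq_LIMSEQ[OF LIMSEQ_Suc[OF summable_LIMSEQ_zero[OF e_summable]] r] by (simp add: o_def)
  \<comment> \<open>The step sizes \<open>sig k i\<close> need not converge; bounding them by \<open>M\<close> leaves an inequality whose two
    sides have limits.\<close>
  have vi: "- (M * (\<bar>(?x k - ?x (Suc k)) \<bullet> (y - ?x (Suc k))\<bar> + e (Suc k))) \<le> ?g k \<bullet> (y - ?x (Suc k))" for k
  proof -
    have \<sigma>: "0 < sig k i" "sig k i \<le> M" using sig[OF i, of k] Ml_pos by auto
    have "sig k i * ((?x k - (1 / sig k i) *\<^sub>R ?g k - ?x (Suc k)) \<bullet> (y - ?x (Suc k))) \<le> sig k i * e (Suc k)"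
      using variational[OF i y, of k] \<sigma> by (intro mult_left_mono) auto
    also have "sig k i * ((?x k - (1 / sig k i) *\<^sub>R ?g k - ?x (Suc k)) \<bullet> (y - ?x (Suc k)))
        = sig k i * ((?x k - ?x (Suc k)) \<bullet> (y - ?x (Suc k))) - ?g k \<bullet> (y - ?x (Suc k))"
      using \<sigma> by (simp add: inner_diff_left right_diff_distrib)
    finally have 1: "sig k i * ((?x k - ?x (Suc k)) \<bullet> (y - ?x (Suc k))) - sig k i * e (Suc k)
        \<le> ?g k \<bullet> (y - ?x (Suc k))" by simp
    have 2: "sig k i * (- ((?x k - ?x (Suc k)) \<bullet> (y - ?x (Suc k))) + e (Suc k))
        \<le> sig k i * (\<bar>(?x k - ?x (Suc k)) \<bullet> (y - ?x (Suc k))\<bar> + e (Suc k))"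
      using \<sigma> by (intro mult_left_mono) auto
    have 3: "sig k i * (\<bar>(?x k - ?x (Suc k)) \<bullet> (y - ?x (Suc k))\<bar> + e (Suc k))
        \<le> M * (\<bar>(?x k - ?x (Suc k)) \<bullet> (y - ?x (Suc k))\<bar> + e (Suc k))"
      using \<sigma> e_nonneg by (intro mult_right_mono) auto
    show ?thesis using 1 order_trans[OF 2 3] unfolding distrib_left by simp
  qed
  have "(\<lambda>j. - (M * (\<bar>(?x (r j) - ?x (Suc (r j))) \<bullet> (y - ?x (Suc (r j)))\<bar> + e (Suc (r j)))))
      \<longlonglongrightarrow> - (M * (\<bar>0 \<bullet> (y - block blk i w)\<bar> + 0))"
    by (intro tendsto_intros x_step y_lim e_lim)
  moreover have "(\<lambda>j. ?g (r j) \<bullet> (y - ?x (Suc (r j)))) \<longlonglongrightarrow> block_grad blk i f w \<bullet> (y - block blk i w)"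
    by (rule tendsto_inner[OF g_lim y_lim])
  ultimately have "- (M * (\<bar>0 \<bullet> (y - block blk i w)\<bar> + 0)) \<le> block_grad blk i f w \<bullet> (y - block blk i w)"
    by (rule LIMSEQ_le) (simp only: vi, blast)
  then show ?thesis by simp
qed

text \<open>
  Testing each of the two projection inequalities with (a feasible point near) the other solution and
  adding them bounds the squared distance of the inexact and the exact step by a multiple of \<open>e\<close>.
\<close>

lemma exact_solutions_close:
  assumes feas: "\<And>k i. i \<in> {1..n} \<Longrightarrow> block blk i (zb (Suc k)) \<in> S i"
    and exact: "\<And>k i y. i \<in> {1..n} \<Longrightarrow> y \<in> S i \<Longrightarrow>
      (block blk i (z k) - (1 / sig k i) *\<^sub>R partial_grad blk f z k i - block blk i (zb (Suc k)))
        \<bullet> (y - block blk i (zb (Suc k))) \<le> 0"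
  shows "(\<lambda>k. zb (Suc k) - z (Suc k)) \<longlonglongrightarrow> 0"
proof -
  obtain D where D: "0 \<le> D" "\<forall>x\<in>P. \<forall>y\<in>P. norm (x - y) \<le> D" using P_diameter by blast
  obtain B where B: "0 \<le> B" "\<forall>i\<in>{1..n}. \<forall>x\<in>P. norm (block_grad blk i f x) \<le> B"
    using block_grad_bounded by blast
  define K where "K = D + B / Ml + 1"
  have zbP: "zb (Suc k) \<in> P" for k
    using feas S_subset unfolding block_prod_def by blast
  have blk_le: "(norm (block blk i (zb (Suc k) - z (Suc k))))\<^sup>2 \<le> K * e (Suc k)" if i: "i \<in> {1..n}" for i k
  proof -
    let ?xt = "block blk i (z k) - (1 / sig k i) *\<^sub>R partial_grad blk f z k i"
    let ?x = "block blk i (z (Suc k))" and ?xb = "block blk i (zb (Suc k))"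
    obtain y where y: "y \<in> S i" "norm (?x - y) \<le> e (Suc k)" using nearby_feasible_block[OF i] by blast
    have \<sigma>: "Ml \<le> sig k i" "0 < sig k i" using sig(1)[OF i, of k] Ml_pos by auto
    have gB: "norm (partial_grad blk f z k i) \<le> B"
      unfolding partial_grad_def using B(2) i mixed_in_P by blast
    have "norm (?xt - ?xb) = norm (block blk i (z k - zb (Suc k)) - (1 / sig k i) *\<^sub>R partial_grad blk f z k i)"
      by (simp add: block_diff algebra_simps)
    also have "\<dots> \<le> norm (block blk i (z k - zb (Suc k))) + norm ((1 / sig k i) *\<^sub>R partial_grad blk f z k i)"
      by (rule norm_triangle_ineq4)
    also have "norm (block blk i (z k - zb (Suc k))) \<le> D"
      using norm_block_le[of blk i "z k - zb (Suc k)"] D(2) z_in[of k] zbP[of k] by (meson order_trans)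
    also have "norm ((1 / sig k i) *\<^sub>R partial_grad blk f z k i) \<le> B / Ml"
      using gB \<sigma> Ml_pos B(1) by (simp add: frac_le)
    finally have xt: "norm (?xt - ?xb) \<le> D + B / Ml" by simp
    have "(?xt - ?xb) \<bullet> (?x - y) \<le> norm (?xt - ?xb) * norm (?x - y)" by (rule norm_cauchy_schwarz)
    also have "\<dots> \<le> (D + B / Ml) * e (Suc k)"
      using xt y(2) by (intro mult_mono) (auto intro: order_trans[OF norm_ge_zero])
    finally have 1: "(?xt - ?xb) \<bullet> (?x - y) \<le> (D + B / Ml) * e (Suc k)" .
    have 2: "(?xt - ?xb) \<bullet> (y - ?xb) \<le> 0" by (rule exact[OF i y(1)])
    have 3: "(?xt - ?x) \<bullet> (?xb - ?x) \<le> e (Suc k)" by (rule variational[OF i feas[OF i]])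
    have "(norm (block blk i (zb (Suc k) - z (Suc k))))\<^sup>2
        = (?xt - ?xb) \<bullet> (?x - y) + (?xt - ?xb) \<bullet> (y - ?xb) + (?xt - ?x) \<bullet> (?xb - ?x)"
      unfolding block_diff power2_norm_eq_inner by (simp add: inner_diff_left inner_diff_right)
    also have "\<dots> \<le> (D + B / Ml) * e (Suc k) + 0 + e (Suc k)"
      using 1 2 3 by (intro add_mono)
    finally show ?thesis by (simp add: K_def distrib_right)
  qed
  have "(norm (zb (Suc k) - z (Suc k)))\<^sup>2 \<le> real n * (K * e (Suc k))" for k
  proof -
    have "(norm (zb (Suc k) - z (Suc k)))\<^sup>2 = (\<Sum>i\<in>{1..n}. (norm (block blk i (zb (Suc k) - z (Suc k))))\<^sup>2)"
      by (rule sum_norm_blocks[OF blk_range, symmetric])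
    also have "\<dots> \<le> (\<Sum>i\<in>{1..n}. K * e (Suc k))" using blk_le by (rule sum_mono)
    finally show ?thesis by simp
  qed
  then have le: "norm ((norm (zb (Suc k) - z (Suc k)))\<^sup>2) \<le> real n * (K * e (Suc k))" for k by simp
  have "(\<lambda>k. real n * (K * e (Suc k))) \<longlonglongrightarrow> 0"
    by (intro tendsto_mult_right_zero LIMSEQ_Suc summable_LIMSEQ_zero e_summable)
  then have "(\<lambda>k. (norm (zb (Suc k) - z (Suc k)))\<^sup>2) \<longlonglongrightarrow> 0"
    by (rule Lim_null_comparison[rotated]) (simp only: le eventually_True)
  then show ?thesis by (simp add: power_tendsto_0_iff tendsto_norm_zero_iff)
qed

end

section \<open>Stationary points of the constrained objective\<close>

lemma objective_on_feasible:
  assumes "w \<in> block_prod blk n (feasible blk p h)"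
  shows "objective blk n p f h w = ereal (f w)"
proof -
  have "(\<Sum>i\<in>{1..n}. indicator_fun (feasible blk p h i) (block blk i w)) = (\<Sum>i\<in>{1..n}. 0)"
    using assms by (intro sum.cong) (auto simp: block_prod_def indicator_fun_def)
  then show ?thesis by (simp add: objective_def)
qed

lemma objective_off_feasible:
  assumes "w \<notin> block_prod blk n (feasible blk p h)"
  shows "objective blk n p f h w = \<infinity>"
proof -
  obtain i where "i \<in> {1..n}" "block blk i w \<notin> feasible blk p h i"
    using assms unfolding block_prod_def by blast
  then have "(\<Sum>i\<in>{1..n}. indicator_fun (feasible blk p h i) (block blk i w)) = \<infinity>"
    unfolding sum_Pinfty by (auto simp: indicator_fun_def)
  then show ?thesis by (simp add: objective_def)
qed

text \<open>
  Off the feasible set the difference quotient is infinite; on it, the first order term is nonnegative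
  by assumption and only the remainder of the derivative is left.
\<close>

lemma stationary_point_of_variational_inequality:
  fixes f :: "real ^ 'd::finite \<Rightarrow> real"
  assumes f: "(f has_derivative (\<lambda>v. G \<bullet> v)) (at w)"
    and w: "w \<in> block_prod blk n (feasible blk p h)"
    and vi: "\<And>v. v \<in> block_prod blk n (feasible blk p h) \<Longrightarrow> 0 \<le> G \<bullet> (v - w)"
  shows "stationary_point (objective blk n p f h) w"
proof -
  let ?F = "objective blk n p f h" and ?Q = "block_prod blk n (feasible blk p h)"
  let ?X = "\<lambda>v. (?F v - ?F w - ereal (0 \<bullet> (v - w))) / ereal (norm (v - w))"
  have Fw: "?F w = ereal (f w)" using w by (rule objective_on_feasible)
  have "0 \<le> Liminf (at w) ?X"
    unfolding le_Liminf_iff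
  proof (intro allI impI)
    fix y :: ereal assume "y < 0"
    then obtain r where r: "y < ereal r" "ereal r < 0" using ereal_dense2 by blast
    then have "0 < - r" by simp
    then obtain \<delta> where \<delta>: "0 < \<delta>"
      "\<And>v. norm (v - w) < \<delta> \<Longrightarrow> norm (f v - f w - G \<bullet> (v - w)) \<le> - r * norm (v - w)"
      using f unfolding has_derivative_at_alt by blast
    have "y < ?X v" if v: "v \<noteq> w" "dist v w < \<delta>" for v
    proof (cases "v \<in> ?Q")
      case True
      have nz: "0 < norm (v - w)" using v(1) by simp
      have "\<bar>f v - f w - G \<bullet> (v - w)\<bar> \<le> - r * norm (v - w)"
        using \<delta>(2)[of v] v(2) by (simp add: dist_norm)
      then have "r * norm (v - w) \<le> f v - f w" using vi[OF True] by linarith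
      then have "r \<le> (f v - f w) / norm (v - w)" using nz by (simp add: pos_le_divide_eq)
      moreover have "?X v = ereal ((f v - f w) / norm (v - w))"
        using nz by (simp add: objective_on_feasible[OF True] Fw)
      ultimately show ?thesis using r(1) by (metis ereal_less_eq(3) less_le_trans)
    next
      case False
      have X: "?X v = \<infinity>" using v(1) by (simp add: objective_off_feasible[OF False] Fw)
      show ?thesis unfolding X using \<open>y < 0\<close> by (cases y) auto
    qed
    then show "\<forall>\<^sub>F v in at w. y < ?X v"
      unfolding eventually_at using \<delta>(1) by blast
  qed
  then show ?thesis
    by (simp add: stationary_point_def frechet_subdiff_def Fw)
qed

lemma (in inexact_block_prox) accumulation_points_stationary:
  assumes w: "w \<in> accumulation_points z" and S_eq: "\<And>i. i \<in> {1..n} \<Longrightarrow> S i = feasible blk p h i"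
  shows "stationary_point (objective blk n p f h) w"
proof (rule stationary_point_of_variational_inequality)
  let ?G = "grad_on UNIV f w"
  show "(f has_derivative (\<lambda>v. ?G \<bullet> v)) (at w)" by (rule has_derivative_grad_on_UNIV[OF f_diff])
  show "w \<in> block_prod blk n (feasible blk p h)"
    using accumulation_points_feasible[OF w] S_eq by (simp add: block_prod_def)
  fix v assume v: "v \<in> block_prod blk n (feasible blk p h)"
  have "0 \<le> (\<Sum>i\<in>{1..n}. block_grad blk i f w \<bullet> (block blk i v - block blk i w))"
  proof (rule sum_nonneg)
    fix i assume i: "i \<in> {1..n}"
    then have "block blk i v \<in> S i" using v S_eq by (simp add: block_prod_def)
    then show "0 \<le> block_grad blk i f w \<bullet> (block blk i v - block blk i w)"
      by (rule accumulation_points_variational[OF w i])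
  qed
  also have "\<dots> = ?G \<bullet> (\<Sum>i\<in>{1..n}. block blk i (v - w))"
    unfolding inner_sum_right
    by (intro sum.cong) (simp_all only: block_grad_eq_block_grad_on[OF f_diff] block_diff[symmetric] inner_block_block)
  finally show "0 \<le> ?G \<bullet> (v - w)" by (simp only: sum_blocks[OF blk_range])
qed

section \<open>Exact proximal steps\<close>

lemma prox_minimizer_variational_inequality:
  fixes S :: "'a::euclidean_space set"
  assumes S: "convex S" "closed S" and \<sigma>: "0 < \<sigma>"
    and min: "is_arg_min (\<lambda>w. g \<bullet> (w - x) + \<sigma> / 2 * (norm (w - x))\<^sup>2) (\<lambda>w. w \<in> S) xb"
    and y: "y \<in> S"
  shows "(x - (1 / \<sigma>) *\<^sub>R g - xb) \<bullet> (y - xb) \<le> 0"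
proof (rule any_closest_point_dot[OF S])
  let ?xt = "x - (1 / \<sigma>) *\<^sub>R g"
  show "xb \<in> S" "y \<in> S" using min y by (simp_all add: is_arg_min_def)
  \<comment> \<open>Completing the square turns the minimiser into a projection of \<open>?xt\<close>.\<close>
  have sq: "g \<bullet> (w - x) + \<sigma> / 2 * (norm (w - x))\<^sup>2
      = \<sigma> / 2 * (dist ?xt w)\<^sup>2 - (norm g)\<^sup>2 / (2 * \<sigma>)" for w
  proof -
    have "(dist ?xt w)\<^sup>2 = (norm ((w - x) + (1 / \<sigma>) *\<^sub>R g))\<^sup>2"
      by (simp add: dist_norm norm_minus_commute algebra_simps)
    also have "\<dots> = (norm (w - x))\<^sup>2 + 2 / \<sigma> * (g \<bullet> (w - x)) + (norm g)\<^sup>2 / \<sigma>\<^sup>2"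
      unfolding power2_norm_eq_inner
      by (simp add: inner_add_left inner_add_right inner_commute power2_eq_square)
    finally show ?thesis using \<sigma> by (simp add: field_simps power2_eq_square)
  qed
  show "\<forall>w\<in>S. dist ?xt xb \<le> dist ?xt w"
  proof
    fix w assume "w \<in> S"
    then have "\<sigma> / 2 * (dist ?xt xb)\<^sup>2 \<le> \<sigma> / 2 * (dist ?xt w)\<^sup>2"
      using min unfolding is_arg_min_def sq by (auto simp: not_less)
    then have "(dist ?xt xb)\<^sup>2 \<le> (dist ?xt w)\<^sup>2" using \<sigma> by simp
    then show "dist ?xt xb \<le> dist ?xt w" by (rule power2_le_imp_le) simp
  qed
qed

section \<open>Convergence of the inexact proximal alternating linearized method\<close>

theorem proposition4p4:
  fixes blk :: "'d::finite \<Rightarrow> nat"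
    and n :: nat and m p :: "nat \<Rightarrow> nat"
    and f :: "real ^ 'd \<Rightarrow> real"
    and h :: "nat \<Rightarrow> nat \<Rightarrow> real ^ 'd \<Rightarrow> real"
    and z zbar :: "nat \<Rightarrow> real ^ 'd"
    and sig :: "nat \<Rightarrow> nat \<Rightarrow> real"
    and eps :: "nat \<Rightarrow> real"
    and epsbar \<gamma> Ml M :: real
    and L :: "nat \<Rightarrow> real"
    and \<Omega> :: "(real ^ 'd) set"
    and F :: "real ^ 'd \<Rightarrow> ereal"
  assumes n_pos: "0 < n"
    and blk_range: "\<forall>j. blk j \<in> {1..n}"
    and dims: "\<forall>i\<in>{1..n}. 0 < m i \<and> card {j. blk j = i} = m i \<and> 0 < p i"
    and f_diff: "f differentiable_on UNIV"
    and h_convex: "\<forall>i\<in>{1..n}. \<forall>c\<in>{1..p i}. convex_on (block_space blk i) (h i c)"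
    and h_diff: "\<forall>i\<in>{1..n}. \<forall>c\<in>{1..p i}. h i c differentiable_on block_space blk i"
    and F_eq: "F = objective blk n p f h"
    and gamma: "1 < \<gamma>"
    and Ml_eq: "Ml = \<gamma> * Max (L ` {1..n})"
    and run: "palm_I blk n p f h epsbar eps Ml M sig z"
    and exact: "exact_solutions blk n p f h sig z zbar"
    and eps_summable: "summable (\<lambda>k. (eps k)\<^sup>2)"
    and lipschitz: "\<forall>i\<in>{1..n}. 0 < L i \<and>
        (\<forall>z1\<in>block_prod blk n (S_bar blk p h epsbar).
         \<forall>z2\<in>block_prod blk n (S_bar blk p h epsbar).
           norm (block_grad blk i f z1 - block_grad blk i f z2) \<le> L i * norm (z1 - z2))"
    and constraints: "\<forall>i\<in>{1..n}.
        convex (feasible blk p h i) \<and> compact (feasible blk p h i) \<and>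
        (linear_constraints blk p h i \<or> slater blk p h i) \<and>
        (\<exists>ct\<ge>0. \<forall>x\<in>S_tilde blk n p f h epsbar Ml i.
           infdist x (feasible blk p h i) \<le> ct * L2_set (\<lambda>c. max (h i c x) 0) {1..p i})"
    and Omega_eq: "\<Omega> = accumulation_points z"
  shows "(\<Omega> \<subseteq> block_prod blk n (feasible blk p h) \<and> \<Omega> \<noteq> {} \<and>
            (\<forall>w\<in>\<Omega>. stationary_point F w)) \<and>
         (compact \<Omega> \<and> connected \<Omega> \<and> (\<lambda>k. infdist (zbar k) \<Omega>) \<longlonglongrightarrow> 0) \<and>
         (\<exists>c::real. \<forall>w\<in>\<Omega>. F w = ereal c)"
proof -
  let ?S = "feasible blk p h" and ?C = "S_bar blk p h epsbar"
  let ?P = "block_prod blk n ?C" and ?q = "sqrt (real CARD('d))"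
  have epsbar: "0 < epsbar" and Ml: "0 < Ml"
    and sig: "\<And>k i. i \<in> {1..n} \<Longrightarrow> sig k i \<in> {Ml..M}"
    using run unfolding palm_I_def by blast+
  have conv: "convex (?S i)" and comp: "compact (?S i)" and pos: "0 < p i"
    and hc: "\<forall>c\<in>{1..p i}. convex_on (block_space blk i) (h i c)"
    and hd: "\<forall>c\<in>{1..p i}. h i c differentiable_on block_space blk i" if "i \<in> {1..n}" for i
    using that constraints dims h_convex h_diff by blast+
  have clo: "closed (?S i)" if "i \<in> {1..n}" for i using comp[OF that] by (rule compact_imp_closed)
  have arg_min: "is_arg_min (\<lambda>w. partial_grad blk f z k i \<bullet> (w - block blk i (z k))
      + sig k i / 2 * (norm (w - block blk i (z k)))\<^sup>2) (\<lambda>w. w \<in> ?S i) (block blk i (zbar (Suc k)))"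
    if "i \<in> {1..n}" for k i
    using exact that unfolding exact_solutions_def by blast
  have zbar_feas: "block blk i (zbar (Suc k)) \<in> ?S i" if "i \<in> {1..n}" for k i
    using arg_min[OF that, of k] by (simp add: is_arg_min_def)
  have ne: "?S i \<noteq> {}" if "i \<in> {1..n}" for i using zbar_feas[OF that] by blast

  have C_eq: "?C i = {w \<in> block_space blk i. infdist w (?S i) \<le> epsbar}" for i
    by (rule S_bar_def)
  have C_comp: "compact (?C i)" if "i \<in> {1..n}" for i
    unfolding C_eq
    by (rule compact_infdist_sublevel[OF closed_subspace[OF subspace_block_space] comp[OF that] ne[OF that]])
  have C_Int: "?C i = block_space blk i \<inter> {w. infdist w (?S i) \<le> epsbar}" for i
    unfolding C_eq by blast
  have C_conv: "convex (?C i)" if "i \<in> {1..n}" for i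
    unfolding C_Int
    by (rule convex_Int[OF subspace_imp_convex[OF subspace_block_space]
        convex_infdist_sublevel[OF conv[OF that] clo[OF that] ne[OF that]]])
  have S_sub: "?S i \<subseteq> ?C i" for i
    using epsbar by (auto simp: C_eq feasible_def)
  have lip: "norm (block_grad blk i f z1 - block_grad blk i f z2) \<le> L i * norm (z1 - z2)"
    if "i \<in> {1..n}" "z1 \<in> ?P" "z2 \<in> ?P" for i z1 z2
    using lipschitz that by blast
  have zbarP: "zbar 1 \<in> ?P"
    using zbar_feas[of _ 0] S_sub unfolding block_prod_def One_nat_def by blast
  \<comment> \<open>The error bound is stated on the sets \<open>S_tilde\<close>; they contain \<open>?C i\<close> because their radius is
    nonnegative, being a supremum of norms over a nonempty bounded set.\<close>
  have C_tilde: "?C i \<subseteq> S_tilde blk n p f h epsbar Ml i" if i: "i \<in> {1..n}" for i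
  proof
    fix w assume w: "w \<in> ?C i"
    have "bounded (block_grad blk i f ` ?P)"
      using compact_imp_bounded[OF compact_block_prod[OF blk_range C_comp]] lip[OF i]
      by (rule bounded_image_of_lipschitz)
    then obtain b where b: "\<And>x. x \<in> ?P \<Longrightarrow> norm (block_grad blk i f x) \<le> b"
      unfolding bounded_iff by blast
    have "norm (block_grad blk i f (zbar 1)) \<le> M_bar blk n p f h epsbar i"
      unfolding M_bar_def by (intro cSUP_upper[OF zbarP] bdd_aboveI2[of _ _ b] b)
    then have "0 \<le> M_bar blk n p f h epsbar i" using norm_ge_zero order_trans by blast
    then have "infdist w (?C i) \<le> M_bar blk n p f h epsbar i / Ml" using w Ml by simp
    then show "w \<in> S_tilde blk n p f h epsbar Ml i"
      using w unfolding S_tilde_def C_eq by blast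
  qed

  have res: "\<exists>lam. (\<forall>c\<in>{1..p i}. 0 \<le> lam c) \<and>
      residual blk p h i (block blk i (z (Suc k))) lam
        (block blk i (z k) - (1 / sig k i) *\<^sub>R partial_grad blk f z k i) \<le> (eps k)\<^sup>2"
    if "i \<in> {1..n}" for k i
    using run that unfolding palm_I_def Let_def by (meson sqrt_le_D)
  have viol: "h i c (block blk i (z (Suc k))) \<le> (eps k)\<^sup>2" if "i \<in> {1..n}" "c \<in> {1..p i}" for k i c
    using res[OF that(1), of k] residual_leD(3)[of p i, OF pos[OF that(1)]] that(2) by blast

  have "\<forall>i\<in>{1..n}. \<exists>r\<ge>0. \<forall>y\<in>?S i. norm y \<le> r"
  proof
    fix i assume i: "i \<in> {1..n}"
    obtain b where b: "\<forall>y\<in>?S i. norm y \<le> b"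
      using compact_imp_bounded[OF comp[OF i]] unfolding bounded_iff by blast
    have "0 \<le> b" using b zbar_feas[OF i, of 0] norm_ge_zero order_trans by blast
    with b show "\<exists>r\<ge>0. \<forall>y\<in>?S i. norm y \<le> r" by blast
  qed
  from bchoice[OF this] obtain R where R: "\<And>i. i \<in> {1..n} \<Longrightarrow> 0 \<le> R i"
    "\<And>i y. i \<in> {1..n} \<Longrightarrow> y \<in> ?S i \<Longrightarrow> norm y \<le> R i" by blast
  have "\<forall>i\<in>{1..n}. \<exists>ct\<ge>0. \<forall>x\<in>S_tilde blk n p f h epsbar Ml i.
      infdist x (?S i) \<le> ct * L2_set (\<lambda>c. max (h i c x) 0) {1..p i}"
    using constraints by blast
  from bchoice[OF this] obtain ct where ct: "\<And>i. i \<in> {1..n} \<Longrightarrow> 0 \<le> ct i"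
    "\<And>i x. i \<in> {1..n} \<Longrightarrow> x \<in> S_tilde blk n p f h epsbar Ml i \<Longrightarrow>
      infdist x (?S i) \<le> ct i * L2_set (\<lambda>c. max (h i c x) 0) {1..p i}" by blast
  \<comment> \<open>A single constant for all blocks: the first summand serves the distance to the feasible set, the
    second the projection inequality.\<close>
  define K where "K = (\<Sum>i\<in>{1..n}. ct i * real (p i) + (2 + ?q * R i))"
  have K_ge: "ct i * real (p i) \<le> K" "2 + ?q * R i \<le> K" if i: "i \<in> {1..n}" for i
  proof -
    have "ct i * real (p i) + (2 + ?q * R i) \<le> K"
      unfolding K_def using i ct(1) R(1) by (intro member_le_sum) auto
    moreover have "0 \<le> ct i * real (p i)" "0 \<le> ?q * R i" using ct(1)[OF i] R(1)[OF i] by simp_all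
    ultimately show "ct i * real (p i) \<le> K" "2 + ?q * R i \<le> K" by linarith+
  qed
  have K: "0 \<le> K" unfolding K_def using ct(1) R(1) by (intro sum_nonneg) auto

  \<comment> \<open>Since \<open>eps\<close> tends to \<open>0\<close>, all iterates from some index on lie in the product of the sets \<open>?C i\<close>.\<close>
  have "\<forall>i\<in>{1..n}. \<exists>\<mu>>0. \<forall>w\<in>block_space blk i. (\<forall>c\<in>{1..p i}. h i c w \<le> \<mu>) \<longrightarrow> infdist w (?S i) \<le> epsbar"
  proof
    fix i assume i: "i \<in> {1..n}"
    show "\<exists>\<mu>>0. \<forall>w\<in>block_space blk i. (\<forall>c\<in>{1..p i}. h i c w \<le> \<mu>) \<longrightarrow> infdist w (?S i) \<le> epsbar"
      by (rule infdist_le_of_small_violation[OF subspace_block_space finite_atLeastAtMost _ _ feasible_def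
          comp[OF i] ne[OF i] epsbar])
        (use hc[OF i] differentiable_imp_continuous_on hd[OF i] in blast)+
  qed
  from bchoice[OF this] obtain \<mu> where \<mu>: "\<And>i. i \<in> {1..n} \<Longrightarrow> 0 < \<mu> i"
    "\<And>i w. i \<in> {1..n} \<Longrightarrow> w \<in> block_space blk i \<Longrightarrow> \<forall>c\<in>{1..p i}. h i c w \<le> \<mu> i \<Longrightarrow>
      infdist w (?S i) \<le> epsbar" by blast
  have "\<forall>\<^sub>F k in sequentially. \<forall>i\<in>{1..n}. (eps k)\<^sup>2 < \<mu> i"
    by (intro eventually_ball_finite finite_atLeastAtMost ballI
        order_tendstoD(2)[OF summable_LIMSEQ_zero[OF eps_summable]] \<mu>(1))
  then obtain N where N: "\<And>k i. N \<le> k \<Longrightarrow> i \<in> {1..n} \<Longrightarrow> (eps k)\<^sup>2 < \<mu> i"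
    unfolding eventually_sequentially by blast
  have z_C: "block blk i (z (Suc k)) \<in> ?C i" if i: "i \<in> {1..n}" and k: "N \<le> k" for k i
  proof -
    have "\<forall>c\<in>{1..p i}. h i c (block blk i (z (Suc k))) \<le> \<mu> i"
      using viol[OF i, of _ k] N[OF k i] by fastforce
    then show ?thesis using \<mu>(2)[OF i block_in_block_space] block_in_block_space unfolding C_eq by blast
  qed
  have near: "infdist (block blk i (z (Suc k))) (?S i) \<le> K * (eps k)\<^sup>2"
    if i: "i \<in> {1..n}" and k: "N \<le> k" for k i
  proof -
    let ?x = "block blk i (z (Suc k))"
    have "L2_set (\<lambda>c. max (h i c ?x) 0) {1..p i} \<le> (\<Sum>c\<in>{1..p i}. max (h i c ?x) 0)"
      by (rule L2_set_le_sum) simp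
    also have "\<dots> \<le> (\<Sum>c\<in>{1..p i}. (eps k)\<^sup>2)"
      using viol[OF i, of _ k] by (intro sum_mono) simp
    finally have "L2_set (\<lambda>c. max (h i c ?x) 0) {1..p i} \<le> real (p i) * (eps k)\<^sup>2" by simp
    then have "ct i * L2_set (\<lambda>c. max (h i c ?x) 0) {1..p i} \<le> ct i * (real (p i) * (eps k)\<^sup>2)"
      using ct(1)[OF i] by (rule mult_left_mono)
    moreover have "infdist ?x (?S i) \<le> ct i * L2_set (\<lambda>c. max (h i c ?x) 0) {1..p i}"
      using ct(2)[OF i] C_tilde[OF i] z_C[OF i k] by blast
    moreover have "ct i * real (p i) * (eps k)\<^sup>2 \<le> K * (eps k)\<^sup>2"
      using K_ge(1)[OF i] by (rule mult_right_mono) simp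
    ultimately show ?thesis by (simp add: mult.assoc)
  qed
  have var: "(block blk i (z k) - (1 / sig k i) *\<^sub>R partial_grad blk f z k i - block blk i (z (Suc k)))
      \<bullet> (y - block blk i (z (Suc k))) \<le> K * (eps k)\<^sup>2" if i: "i \<in> {1..n}" and y: "y \<in> ?S i" for k i y
  proof -
    obtain lam where lam: "\<forall>c\<in>{1..p i}. 0 \<le> lam c"
      and r: "residual blk p h i (block blk i (z (Suc k))) lam
        (block blk i (z k) - (1 / sig k i) *\<^sub>R partial_grad blk f z k i) \<le> (eps k)\<^sup>2"
      using res[OF i] by blast
    have "(block blk i (z k) - (1 / sig k i) *\<^sub>R partial_grad blk f z k i - block blk i (z (Suc k)))
      \<bullet> (y - block blk i (z (Suc k))) \<le> (2 + ?q * R i) * (eps k)\<^sup>2"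
      by (rule residual_variational_inequality[OF pos[OF i] r lam hc[OF i] hd[OF i]
          block_in_block_space y R(2)[OF i y]])
    also have "\<dots> \<le> K * (eps k)\<^sup>2" using K_ge(2)[OF i] by (rule mult_right_mono) simp
    finally show ?thesis .
  qed

  \<comment> \<open>The first index with \<open>z k \<in> ?P\<close> for certain is \<open>Suc N\<close>, and the step that produced \<open>z (k + Suc N)\<close>
    had tolerance \<open>eps (k + N)\<close>.\<close>
  define z' where "z' k = z (k + Suc N)" for k
  define sig' where "sig' k = sig (k + Suc N)" for k
  define e where "e k = K * (eps (k + N))\<^sup>2" for k
  have pg: "partial_grad blk f z' k i = partial_grad blk f z (k + Suc N) i" for k i
    by (simp add: partial_grad_def z'_def)
  have L_Max: "L i \<le> Max (L ` {1..n})" if "i \<in> {1..n}" for i using that by simp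
  have L1: "0 < L 1" using lipschitz n_pos by simp
  have "1 \<in> {1..n}" using n_pos by simp
  then have Max_pos: "0 < Max (L ` {1..n})" by (rule less_le_trans[OF L1 L_Max])
  have Max_Ml: "Max (L ` {1..n}) \<le> Ml"
    using gamma Max_pos unfolding Ml_eq by simp
  interpret prox: inexact_block_prox blk n f ?S ?C L Ml M sig' z' e
  proof
    show "\<forall>j. blk j \<in> {1..n}" "f differentiable_on UNIV" "0 < Ml" by fact+
    show "summable e" unfolding e_def
      by (rule summable_mult[OF summable_ignore_initial_segment[OF eps_summable]])
    show "0 \<le> e k" for k using K by (simp add: e_def)
    show "z' k \<in> ?P" for k
      using z_C[of _ "k + N"] by (simp add: z'_def block_prod_def)
    fix i assume i: "i \<in> {1..n}"
    show "closed (?S i)" "?S i \<noteq> {}" "?S i \<subseteq> ?C i" "convex (?C i)" "compact (?C i)"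
      using clo[OF i] ne[OF i] S_sub C_conv[OF i] C_comp[OF i] .
    show "norm (block_grad blk i f z1 - block_grad blk i f z2) \<le> L i * norm (z1 - z2)"
      if "z1 \<in> ?P" "z2 \<in> ?P" for z1 z2 using lip[OF i that] .
    show "L i \<le> Ml" using L_Max[OF i] Max_Ml by linarith
    show "Ml \<le> sig' k i" "sig' k i \<le> M" for k using sig[OF i] by (simp_all add: sig'_def)
    show "infdist (block blk i (z' k)) (?S i) \<le> e k" for k
      using near[OF i, of "k + N"] by (simp add: z'_def e_def)
    show "(block blk i (z' k) - (1 / sig' k i) *\<^sub>R partial_grad blk f z' k i - block blk i (z' (Suc k)))
        \<bullet> (y - block blk i (z' (Suc k))) \<le> e (Suc k)" if "y \<in> ?S i" for y k
      using var[OF i that, of "k + Suc N"] unfolding pg by (simp add: z'_def sig'_def e_def)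
  qed
  have Omega: "\<Omega> = accumulation_points z'"
    unfolding Omega_eq z'_def by (rule accumulation_points_shift[symmetric])

  have close: "(\<lambda>k. zbar (Suc (k + Suc N)) - z' (Suc k)) \<longlonglongrightarrow> 0"
  proof -
    have "(\<lambda>k. (\<lambda>k. zbar (k + Suc N)) (Suc k) - z' (Suc k)) \<longlonglongrightarrow> 0"
    proof (rule prox.exact_solutions_close)
      fix k i assume i: "i \<in> {1..n}"
      show "block blk i (zbar (Suc k + Suc N)) \<in> ?S i" using zbar_feas[OF i, of "k + Suc N"] by simp
      fix y assume y: "y \<in> ?S i"
      have "0 < sig (k + Suc N) i" using sig[OF i, of "k + Suc N"] Ml by simp
      from prox_minimizer_variational_inequality[OF conv[OF i] clo[OF i] this arg_min[OF i] y]
      show "(block blk i (z' k) - (1 / sig' k i) *\<^sub>R partial_grad blk f z' k i - block blk i (zbar (Suc k + Suc N)))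
        \<bullet> (y - block blk i (zbar (Suc k + Suc N))) \<le> 0"
        unfolding pg by (simp add: z'_def sig'_def)
    qed
    then show ?thesis by simp
  qed
  have zbar_Omega: "(\<lambda>k. infdist (zbar k) \<Omega>) \<longlonglongrightarrow> 0"
  proof (rule LIMSEQ_offset[of _ "Suc (Suc N)"])
    have "(\<lambda>k. infdist (z' (Suc k)) \<Omega> + norm (zbar (Suc (k + Suc N)) - z' (Suc k))) \<longlonglongrightarrow> 0 + 0"
      unfolding Omega
      by (intro tendsto_add LIMSEQ_Suc[OF infdist_accumulation_points_tendsto_0[OF prox.bounded_range]]
          tendsto_norm_zero close)
    then have lim: "(\<lambda>k. infdist (z' (Suc k)) \<Omega> + norm (zbar (Suc (k + Suc N)) - z' (Suc k))) \<longlonglongrightarrow> 0"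
      by simp
    have le: "norm (infdist (zbar (k + Suc (Suc N))) \<Omega>)
        \<le> infdist (z' (Suc k)) \<Omega> + norm (zbar (Suc (k + Suc N)) - z' (Suc k))" for k
      using infdist_triangle[of "zbar (k + Suc (Suc N))" \<Omega> "z' (Suc k)"]
      by (simp add: dist_norm infdist_nonneg)
    show "(\<lambda>k. infdist (zbar (k + Suc (Suc N))) \<Omega>) \<longlonglongrightarrow> 0"
      by (rule Lim_null_comparison[OF _ lim]) (simp only: le eventually_True)
  qed
  have feas: "\<Omega> \<subseteq> block_prod blk n ?S"
    unfolding Omega using prox.accumulation_points_feasible by blast
  obtain c where c: "\<And>w. w \<in> \<Omega> \<Longrightarrow> f w = c"
    using prox.accumulation_points_value unfolding Omega by blast
  have "F w = ereal c" if "w \<in> \<Omega>" for w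
    using objective_on_feasible[of w blk n p h f] feas that c[OF that] unfolding F_eq by auto
  moreover have "stationary_point F w" if "w \<in> \<Omega>" for w
    using prox.accumulation_points_stationary[of w p h] that unfolding Omega F_eq by blast
  moreover have "\<Omega> \<noteq> {}" unfolding Omega by (rule accumulation_points_nonempty[OF prox.bounded_range])
  moreover have "compact \<Omega>" unfolding Omega by (rule compact_accumulation_points[OF prox.bounded_range])
  moreover have "connected \<Omega>"
    unfolding Omega by (rule connected_accumulation_points[OF prox.bounded_range prox.steps_tendsto_0])
  ultimately show ?thesis using feas zbar_Omega by blast
qed

end
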